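(* Let $\vec P=(P_1,\dots,P_d)\in [H^1_0(\Omega)]^d$ and let $V_{\vec P}=\Phi(\rho-\operatorname{div}\vec P)$. Then $I(\vec P)=G(V_{\vec P},\vec P)$. Moreover, the $L^2(\Omega)$ gradient flow of $I$, $$\rho_i\,\partial_t P_i=-\delta_{P_i} I(\vec P),\qquad i=1,\dots,d,$$ with $\rho_i=0$ if $P_i$ follows the dielectric property and $\rho_i>0$ if $P_i$ follows the ferroelectric property, understood weakly as $\rho_i(\partial_tP_i,Q_i)=-\delta_{P_i}I(\vec P)[Q_i]$ for all $Q_i\in H^1_0(\Omega)$, coincides with the following system with $V=V_{\vec P}$: (1) $-(\epsilon\nabla V,\nabla w)+(\rho-\operatorname{div}\vec P,w)=0$ for all $w\in\mathcal V_D$; (2) for each $i$ such that $P_i$ follows the dielectric property, $2\alpha_i(P_i,Q_i)+(\partial_{x_i}V,Q_i)=0$ for all $Q_i\in H^1_0(\Omega)$; (3) for each $i$ such that $P_i$ follows the ferroelectric property, $\rho_i(\partial_tP_i,Q_i)+g_i(\nabla P_i,\nabla Q_i)+(DF(P_i)P_i,Q_i)+(\partial_{x_i}V,Q_i)=0$ for all $Q_i\in H^1_0(\Omega)$.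
   Context: $\Omega\subset\mathbb R^d$ ($d\le 3$) is a bounded domain with Lipschitz boundary; $\partial\Omega=\Gamma_D\cup\Gamma_N$ with $\Gamma_D,\Gamma_N$ disjoint and $\Gamma_D$ of positive surface measure. $\mathcal V_D=\{w\in H^1(\Omega): w=0\text{ on }\Gamma_D\}$. $(\cdot,\cdot)$ is the $L^2(\Omega)$ inner product (extended to a duality product where needed). $\epsilon>0$ is a constant, and $\rho\in L^2(\Omega)$ is the charge distribution (not to be confused with the viscosity constants $\rho_i$). $\Phi:L^2(\Omega)\to\mathcal V_D$ is the solution operator: for $h\in L^2(\Omega)$, $\Phi h\in\mathcal V_D$ is the unique solution of $(\epsilon\nabla\Phi h,\nabla w)=(h,w)$ for all $w\in\mathcal V_D$. For each $i=1,\dots,d$ there are real constants $\alpha_i,\beta_i,\gamma_i,g_i$, and $F(P_i):=\alpha_iP_i^2+\beta_iP_i^4+\gamma_iP_i^6$, $DF(P_i):=2\alpha_i+4\beta_iP_i^2+6\gamma_iP_i^4$ (so $DF(P_i)P_i$ is the derivative of $F(P_i)$ with respect to $P_i$). Each $P_i$ either follows the dielectric property, meaning $\alpha_i>0$ and $\beta_i=\gamma_i=g_i=0$, or follows the ferroelectric property, meaning either $\gamma_i,g_i>0$, or $\gamma_i=0$ and $\beta_i,g_i>0$. The Gibbs free energy is $$G(V,\vec P)=\int_\Omega\Big(\rho V+\vec P\cdot\nabla V-\frac{\epsilon}{2}|\nabla V|^2+\sum_{i=1}^d\big(F(P_i)+\tfrac{g_i}{2}|\nabla P_i|^2\big)\Big)\,dx,$$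 and the modified energy is $$I(\vec P)=\int_\Omega\Big(\frac{\epsilon}{2}|\nabla V_{\vec P}|^2+\sum_{i=1}^dF(P_i)+\sum_{i=1}^d\frac{g_i}{2}|\nabla P_i|^2\Big)\,dx .$$ $\delta_{P_i}$ denotes the (directional/Fréchet) derivative with respect to the component $P_i$. In the gradient flow, $\vec P$ is a time-dependent field regular enough that all terms make sense. *)

theory Defs
  imports "HOL-Analysis.Analysis"
begin

text \<open>
  Points of $\mathbb R^d$ have type \<open>real^'n\<close>, scalar functions on \<open>\<Omega>\<close> are total functions of
  type \<open>real^'n \<Rightarrow> real\<close> whose values outside \<open>\<Omega>\<close> are irrelevant, and a vector field $\vec P$ is
  given by its components \<open>P :: 'n \<Rightarrow> real^'n \<Rightarrow> real\<close>. Elements of $L^2$ and $H^1$ are represented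
  by functions rather than by classes modulo null sets.
\<close>

section \<open>Square integrable functions\<close>

definition L2 :: "'a measure \<Rightarrow> ('a \<Rightarrow> real) set" where
  "L2 M = {f \<in> borel_measurable M. integrable M (\<lambda>x. (f x)\<^sup>2)}"

definition L2_tendsto :: "'a measure \<Rightarrow> ('b \<Rightarrow> 'a \<Rightarrow> real) \<Rightarrow> ('a \<Rightarrow> real) \<Rightarrow> 'b filter \<Rightarrow> bool" where
  "L2_tendsto M f u F \<longleftrightarrow> ((\<lambda>n. \<integral>\<^sup>+x. ennreal ((f n x - u x)\<^sup>2) \<partial>M) \<longlongrightarrow> 0) F"

text \<open>One definition serves scalar and vector valued functions, since \<open>\<bullet>\<close> on \<open>real\<close> is
  multiplication.\<close>
definition l2_inner :: "(real^'n) set \<Rightarrow> (real^'n \<Rightarrow> 'b::real_inner) \<Rightarrow> (real^'n \<Rightarrow> 'b) \<Rightarrow> real" where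
  "l2_inner \<Omega> f g = (LINT x|lebesgue_on \<Omega>. f x \<bullet> g x)"

section \<open>The Sobolev spaces $H^1$ and $H^1_0$\<close>

definition pd :: "(real^'n \<Rightarrow> real) \<Rightarrow> 'n \<Rightarrow> real^'n \<Rightarrow> real" where
  "pd f i x = frechet_derivative f (at x) (axis i 1)"

definition C1 :: "(real^'n \<Rightarrow> real) set" where
  "C1 = {f. (\<forall>x. f differentiable (at x)) \<and> (\<forall>i. continuous_on UNIV (pd f i))}"

definition C1c :: "(real^'n) set \<Rightarrow> (real^'n \<Rightarrow> real) set" where
  "C1c \<Omega> = {f \<in> C1. \<exists>K. compact K \<and> K \<subseteq> \<Omega> \<and> (\<forall>x. x \<notin> K \<longrightarrow> f x = 0)}"

text \<open>As in Brezis' textbook on Sobolev spaces, the test functions are the compactly supported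
  $C^1$ functions; replacing them by $C_c^\infty$ functions gives the same notions.\<close>
definition has_weak_partial ::
  "(real^'n) set \<Rightarrow> (real^'n \<Rightarrow> real) \<Rightarrow> 'n \<Rightarrow> (real^'n \<Rightarrow> real) \<Rightarrow> bool" where
  "has_weak_partial \<Omega> u i v \<longleftrightarrow> v \<in> L2 (lebesgue_on \<Omega>) \<and>
     (\<forall>\<phi>\<in>C1c \<Omega>. l2_inner \<Omega> u (pd \<phi> i) = - l2_inner \<Omega> v \<phi>)"

definition H1 :: "(real^'n) set \<Rightarrow> (real^'n \<Rightarrow> real) set" where
  "H1 \<Omega> = {u \<in> L2 (lebesgue_on \<Omega>). \<forall>i. \<exists>v. has_weak_partial \<Omega> u i v}"

text \<open>A representative of the weak partial derivative, which is unique up to a null set.\<close>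
definition wpd :: "(real^'n) set \<Rightarrow> (real^'n \<Rightarrow> real) \<Rightarrow> 'n \<Rightarrow> real^'n \<Rightarrow> real" where
  "wpd \<Omega> u i = (SOME v. has_weak_partial \<Omega> u i v)"

definition wgrad :: "(real^'n) set \<Rightarrow> (real^'n \<Rightarrow> real) \<Rightarrow> real^'n \<Rightarrow> real^'n" where
  "wgrad \<Omega> u x = (\<chi> i. wpd \<Omega> u i x)"

definition wdiv :: "(real^'n) set \<Rightarrow> ('n \<Rightarrow> real^'n \<Rightarrow> real) \<Rightarrow> real^'n \<Rightarrow> real" where
  "wdiv \<Omega> P x = (\<Sum>i\<in>UNIV. wpd \<Omega> (P i) i x)"

definition H1_tendsto :: "(real^'n) set \<Rightarrow> (nat \<Rightarrow> real^'n \<Rightarrow> real) \<Rightarrow> (real^'n \<Rightarrow> real) \<Rightarrow> bool" where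
  "H1_tendsto \<Omega> f u \<longleftrightarrow> (\<forall>n. f n \<in> H1 \<Omega>) \<and> L2_tendsto (lebesgue_on \<Omega>) f u sequentially \<and>
     (\<forall>i. L2_tendsto (lebesgue_on \<Omega>) (\<lambda>n. wpd \<Omega> (f n) i) (wpd \<Omega> u i) sequentially)"

definition H10 :: "(real^'n) set \<Rightarrow> (real^'n \<Rightarrow> real) set" where
  "H10 \<Omega> = {u \<in> H1 \<Omega>. \<exists>\<phi>. (\<forall>n. \<phi> n \<in> C1c \<Omega>) \<and> H1_tendsto \<Omega> \<phi> u}"

section \<open>Lipschitz boundary, surface measure and traces\<close>

text \<open>Near each boundary point, \<open>\<Omega>\<close> is the region above the graph, in some direction \<open>e\<close>, of a
  Lipschitz function \<open>\<phi>\<close> on the hyperplane orthogonal to \<open>e\<close>.\<close>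
definition lipschitz_boundary :: "(real^'n) set \<Rightarrow> bool" where
  "lipschitz_boundary \<Omega> \<longleftrightarrow> (\<forall>x\<in>frontier \<Omega>. \<exists>U e L \<phi>. open U \<and> x \<in> U \<and> norm e = 1 \<and>
     L-lipschitz_on {y. y \<bullet> e = 0} \<phi> \<and> \<Omega> \<inter> U = {y \<in> U. \<phi> (y - (y \<bullet> e) *\<^sub>R e) < y \<bullet> e})"

definition hausdorff_content :: "nat \<Rightarrow> real \<Rightarrow> 'a::metric_space set \<Rightarrow> ennreal" where
  "hausdorff_content s \<delta> A =
     (INF C\<in>{C :: nat \<Rightarrow> 'a set. A \<subseteq> (\<Union>k. C k) \<and> (\<forall>k. bounded (C k) \<and> diameter (C k) \<le> \<delta>)}.
        \<Sum>k. if C k = {} then 0 else ennreal (unit_ball_vol (real s) * (diameter (C k) / 2) ^ s))"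

definition hausdorff_outer :: "nat \<Rightarrow> 'a::metric_space set \<Rightarrow> ennreal" where
  "hausdorff_outer s A = (SUP \<delta>\<in>{0<..}. hausdorff_content s \<delta> A)"

text \<open>The $(d-1)$-dimensional Hausdorff measure on the Borel sets; it is countably additive there
  because \<open>hausdorff_outer\<close> is a metric outer measure, so \<open>measure_of\<close> does not degenerate.
  For $d=1$ it is the counting measure.\<close>
definition surface_measure :: "(real^'n) measure" where
  "surface_measure = measure_of UNIV (sets borel) (hausdorff_outer (CARD('n) - 1))"

text \<open>The trace operator is the continuous extension to $H^1(\Omega)$ of the restriction
  \<open>f \<mapsto> f|\<partial>\<Omega>\<close> of functions that are $C^1$ up to the boundary.\<close>
definition has_trace :: "(real^'n) set \<Rightarrow> (real^'n \<Rightarrow> real) \<Rightarrow> (real^'n \<Rightarrow> real) \<Rightarrow> bool" where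
  "has_trace \<Omega> u g \<longleftrightarrow> g \<in> L2 (restrict_space surface_measure (frontier \<Omega>)) \<and>
     (\<exists>f. (\<forall>n. f n \<in> C1) \<and> H1_tendsto \<Omega> f u \<and>
          L2_tendsto (restrict_space surface_measure (frontier \<Omega>)) f g sequentially)"

definition VD :: "(real^'n) set \<Rightarrow> (real^'n) set \<Rightarrow> (real^'n \<Rightarrow> real) set" where
  "VD \<Omega> \<Gamma>D = {w \<in> H1 \<Omega>. \<exists>g. has_trace \<Omega> w g \<and>
     (AE x in restrict_space surface_measure (frontier \<Omega>). x \<in> \<Gamma>D \<longrightarrow> g x = 0)}"

section \<open>The potential and the energies\<close>

definition weak_solution ::
  "(real^'n) set \<Rightarrow> (real^'n) set \<Rightarrow> real \<Rightarrow> (real^'n \<Rightarrow> real) \<Rightarrow> (real^'n \<Rightarrow> real) \<Rightarrow> bool" where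
  "weak_solution \<Omega> \<Gamma>D \<epsilon> h u \<longleftrightarrow> u \<in> VD \<Omega> \<Gamma>D \<and>
     (\<forall>w\<in>VD \<Omega> \<Gamma>D. l2_inner \<Omega> (\<lambda>x. \<epsilon> *\<^sub>R wgrad \<Omega> u x) (wgrad \<Omega> w) = l2_inner \<Omega> h w)"

definition solution_operator ::
  "(real^'n) set \<Rightarrow> (real^'n) set \<Rightarrow> real \<Rightarrow> ((real^'n \<Rightarrow> real) \<Rightarrow> real^'n \<Rightarrow> real) \<Rightarrow> bool" where
  "solution_operator \<Omega> \<Gamma>D \<epsilon> \<Phi> \<longleftrightarrow> (\<forall>h\<in>L2 (lebesgue_on \<Omega>). weak_solution \<Omega> \<Gamma>D \<epsilon> h (\<Phi> h) \<and>
     (\<forall>u. weak_solution \<Omega> \<Gamma>D \<epsilon> h u \<longrightarrow> (AE x in lebesgue_on \<Omega>. u x = \<Phi> h x)))"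

text \<open>The field $V_{\vec P}$.\<close>
definition potential ::
  "(real^'n) set \<Rightarrow> ((real^'n \<Rightarrow> real) \<Rightarrow> real^'n \<Rightarrow> real) \<Rightarrow> (real^'n \<Rightarrow> real) \<Rightarrow>
   ('n \<Rightarrow> real^'n \<Rightarrow> real) \<Rightarrow> real^'n \<Rightarrow> real" where
  "potential \<Omega> \<Phi> \<rho> P = \<Phi> (\<lambda>x. \<rho> x - wdiv \<Omega> P x)"

definition F :: "real \<Rightarrow> real \<Rightarrow> real \<Rightarrow> real \<Rightarrow> real" where
  "F a b c p = a * p^2 + b * p^4 + c * p^6"

definition DF :: "real \<Rightarrow> real \<Rightarrow> real \<Rightarrow> real \<Rightarrow> real" where
  "DF a b c p = 2 * a + 4 * b * p^2 + 6 * c * p^4"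

definition dielectric :: "real \<Rightarrow> real \<Rightarrow> real \<Rightarrow> real \<Rightarrow> bool" where
  "dielectric a b c g \<longleftrightarrow> a > 0 \<and> b = 0 \<and> c = 0 \<and> g = 0"

definition ferroelectric :: "real \<Rightarrow> real \<Rightarrow> real \<Rightarrow> real \<Rightarrow> bool" where
  "ferroelectric a b c g \<longleftrightarrow> (c > 0 \<and> g > 0) \<or> (c = 0 \<and> b > 0 \<and> g > 0)"

definition gibbs_energy ::
  "(real^'n) set \<Rightarrow> real \<Rightarrow> (real^'n \<Rightarrow> real) \<Rightarrow> ('n \<Rightarrow> real) \<Rightarrow> ('n \<Rightarrow> real) \<Rightarrow> ('n \<Rightarrow> real) \<Rightarrow>
   ('n \<Rightarrow> real) \<Rightarrow> (real^'n \<Rightarrow> real) \<Rightarrow> ('n \<Rightarrow> real^'n \<Rightarrow> real) \<Rightarrow> real" where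
  "gibbs_energy \<Omega> \<epsilon> \<rho> \<alpha> \<beta> \<gamma> g V P = (LINT x|lebesgue_on \<Omega>.
     \<rho> x * V x + (\<chi> i. P i x) \<bullet> wgrad \<Omega> V x - \<epsilon> / 2 * (norm (wgrad \<Omega> V x))\<^sup>2
     + (\<Sum>i\<in>UNIV. F (\<alpha> i) (\<beta> i) (\<gamma> i) (P i x) + g i / 2 * (norm (wgrad \<Omega> (P i) x))\<^sup>2))"

definition modified_energy ::
  "(real^'n) set \<Rightarrow> real \<Rightarrow> ((real^'n \<Rightarrow> real) \<Rightarrow> real^'n \<Rightarrow> real) \<Rightarrow> (real^'n \<Rightarrow> real) \<Rightarrow>
   ('n \<Rightarrow> real) \<Rightarrow> ('n \<Rightarrow> real) \<Rightarrow> ('n \<Rightarrow> real) \<Rightarrow> ('n \<Rightarrow> real) \<Rightarrow> ('n \<Rightarrow> real^'n \<Rightarrow> real) \<Rightarrow> real" where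
  "modified_energy \<Omega> \<epsilon> \<Phi> \<rho> \<alpha> \<beta> \<gamma> g P = (LINT x|lebesgue_on \<Omega>.
     \<epsilon> / 2 * (norm (wgrad \<Omega> (potential \<Omega> \<Phi> \<rho> P) x))\<^sup>2
     + (\<Sum>i\<in>UNIV. F (\<alpha> i) (\<beta> i) (\<gamma> i) (P i x))
     + (\<Sum>i\<in>UNIV. g i / 2 * (norm (wgrad \<Omega> (P i) x))\<^sup>2))"

text \<open>\<open>E\<close> is differentiable at \<open>P\<close> in the direction \<open>Q\<close> of the \<open>i\<close>th component, with
  $\delta_{P_i} E(\vec P)[Q] = D$.\<close>
definition has_partial_variation ::
  "(('n \<Rightarrow> real^'n \<Rightarrow> real) \<Rightarrow> real) \<Rightarrow> ('n \<Rightarrow> real^'n \<Rightarrow> real) \<Rightarrow> 'n \<Rightarrow> (real^'n \<Rightarrow> real) \<Rightarrow> real \<Rightarrow> bool" where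
  "has_partial_variation E P i Q D \<longleftrightarrow>
     ((\<lambda>s. E (P(i := \<lambda>x. P i x + s * Q x))) has_real_derivative D) (at 0)"

text \<open>Differentiability at time \<open>t\<close> of a curve with values in $L^2(\Omega)$.\<close>
definition has_L2_time_derivative ::
  "(real^'n) set \<Rightarrow> (real \<Rightarrow> real^'n \<Rightarrow> real) \<Rightarrow> (real^'n \<Rightarrow> real) \<Rightarrow> real \<Rightarrow> bool" where
  "has_L2_time_derivative \<Omega> p p' t \<longleftrightarrow> p' \<in> L2 (lebesgue_on \<Omega>) \<and>
     L2_tendsto (lebesgue_on \<Omega>) (\<lambda>h x. (p (t + h) x - p t x) / h) p' (at 0)"

text \<open>The weak form of $\eta_i\,\partial_t P_i = -\delta_{P_i}E(\vec P)$, \<open>dtP\<close> being the time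
  derivative of \<open>P\<close> and \<open>\<eta>\<close> the viscosities.\<close>
definition weak_gradient_flow ::
  "(real^'n) set \<Rightarrow> (('n \<Rightarrow> real^'n \<Rightarrow> real) \<Rightarrow> real) \<Rightarrow> ('n \<Rightarrow> real) \<Rightarrow> real set \<Rightarrow>
   (real \<Rightarrow> 'n \<Rightarrow> real^'n \<Rightarrow> real) \<Rightarrow> (real \<Rightarrow> 'n \<Rightarrow> real^'n \<Rightarrow> real) \<Rightarrow> bool" where
  "weak_gradient_flow \<Omega> E \<eta> J P dtP \<longleftrightarrow> (\<forall>t\<in>J. \<forall>i. \<forall>Q\<in>H10 \<Omega>.
     \<exists>D. has_partial_variation E (P t) i Q D \<and> \<eta> i * l2_inner \<Omega> (dtP t i) Q = - D)"

end

theory Submission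
  imports Defs
begin

text \<open>
  The energy identity is one test of the weak Poisson problem. By definition
  $V = V_{\vec P}$ satisfies $\epsilon\,(\nabla V,\nabla w) = (\rho - \mathrm{div}\,\vec P, w)$ on
  \<open>VD\<close>; with $w = V$ and the integration by parts $-(\mathrm{div}\,\vec P, V) = (\vec P, \nabla V)$,
  which needs no boundary term because each \<open>P i\<close> is an $H^1$ limit of test functions
  (\<open>integration_by_parts_H10\<close>), this gives
  $\epsilon\,\|\nabla V\|^2 = (\rho, V) + (\vec P, \nabla V)$. The electric part of the Gibbs
  energy is therefore $\epsilon\|\nabla V\|^2 - \frac\epsilon2\|\nabla V\|^2$, the electric part of
  the modified energy.

  For the variation, replace \<open>P i\<close> by \<open>P i + s Q\<close>. The right-hand side of the Poisson problem
  changes by $-s\,\partial_i Q$, hence the potential becomes $V - sW$ with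
  $W = \Phi(\partial_i Q)$ (\<open>wgrad_potential_variation\<close>; this uses that \<open>VD\<close> is a linear space
  and that weak solutions are unique). So the electric energy is a quadratic polynomial in $s$
  with linear coefficient $-\epsilon\,(\nabla V,\nabla W) = -(\partial_i Q, V) = (Q, \partial_i V)$.
  The gradient energy is quadratic in $s$, and $\int F(P_i + sQ)$ is a polynomial of degree at
  most six with linear coefficient $\int DF(P_i)P_iQ$. Altogether the variation exists and is
  \[ \delta_{P_i} I(\vec P)[Q] = (\partial_i V, Q) + (DF(P_i)P_i, Q) + g_i(\nabla P_i,\nabla Q) \]
  (\<open>modified_energy_has_partial_variation\<close>). Since derivatives are unique, the weak
  gradient flow says that this quantity equals $-\eta_i(\partial_t P_i, Q)$. For a ferroelectric
  component this is the stated evolution equation; for a dielectric one $\eta_i$, $g_i$ and the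
  nonlinear coefficients vanish, which leaves the stated algebraic equation. The Poisson equation
  holds by the definition of $V$.

  Two analytic facts carry the argument. Weak derivatives are unique up to null sets, by
  the fundamental lemma \<open>AE_eq_0_if_orthogonal_C1c\<close>; this makes the chosen representatives
  \<open>wpd\<close> linear almost everywhere. And $P_i^6$ is integrable for $P_i \in H^1_0$ when $d \le 3$,
  by \<open>Sobolev_inequality_C1\<close> for test functions and Fatou's lemma
  (\<open>H10_integrable_power6\<close>); without it the integrals over $F$ would not be polynomials in $s$.
\<close>

section \<open>Square integrable functions\<close>

lemma L2_measurable [measurable_dest]: "f \<in> L2 M \<Longrightarrow> f \<in> borel_measurable M"
  by (simp add: L2_def)

lemma L2_integrable_square: "f \<in> L2 M \<Longrightarrow> integrable M (\<lambda>x. (f x)\<^sup>2)"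
  by (simp add: L2_def)

lemma L2_integrable_mult:
  assumes "f \<in> L2 M" "g \<in> L2 M"
  shows "integrable M (\<lambda>x. f x * g x)"
proof (rule Bochner_Integration.integrable_bound)
  show "integrable M (\<lambda>x. (f x)\<^sup>2 + (g x)\<^sup>2)"
    using assms by (simp add: L2_integrable_square)
  show "(\<lambda>x. f x * g x) \<in> borel_measurable M"
    using assms by (auto dest!: L2_measurable)
  have "\<bar>a * b\<bar> \<le> a\<^sup>2 + b\<^sup>2" for a b :: real
    using sum_squares_bound[of "\<bar>a\<bar>" "\<bar>b\<bar>"] abs_ge_zero[of "a * b"]
    by (simp only: power2_abs mult.assoc flip: abs_mult)
  then show "AE x in M. norm (f x * g x) \<le> norm ((f x)\<^sup>2 + (g x)\<^sup>2)"
    by (simp add: abs_of_nonneg)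
qed

lemma L2_lincomb:
  assumes "f \<in> L2 M" "g \<in> L2 M"
  shows "(\<lambda>x. f x + c * g x) \<in> L2 M"
proof -
  have "integrable M (\<lambda>x. (f x)\<^sup>2 + 2 * c * (f x * g x) + c\<^sup>2 * (g x)\<^sup>2)"
    using assms L2_integrable_mult[OF assms]
    by (intro Bochner_Integration.integrable_add integrable_mult_right L2_integrable_square)
  moreover have "(f x)\<^sup>2 + 2 * c * (f x * g x) + c\<^sup>2 * (g x)\<^sup>2 = (f x + c * g x)\<^sup>2" for x
    by (simp add: power2_sum power_mult_distrib algebra_simps)
  ultimately show ?thesis
    using assms by (auto simp: L2_def)
qed

lemma L2_zero: "(\<lambda>x. 0) \<in> L2 M"
  by (simp add: L2_def)

lemma L2_add: "f \<in> L2 M \<Longrightarrow> g \<in> L2 M \<Longrightarrow> (\<lambda>x. f x + g x) \<in> L2 M"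
  using L2_lincomb[of f M g 1] by simp

lemma L2_diff: "f \<in> L2 M \<Longrightarrow> g \<in> L2 M \<Longrightarrow> (\<lambda>x. f x - g x) \<in> L2 M"
  using L2_lincomb[of f M g "-1"] by simp

lemma L2_sum: "(\<And>i. i \<in> I \<Longrightarrow> f i \<in> L2 M) \<Longrightarrow> (\<lambda>x. \<Sum>i\<in>I. f i x) \<in> L2 M"
  by (induction I rule: infinite_finite_induct) (auto simp: L2_zero L2_add)

lemma L2_inner_lincomb:
  assumes "f \<in> L2 M" "g \<in> L2 M" "h \<in> L2 M"
  shows "(LINT x|M. (f x + c * g x) * h x) = (LINT x|M. f x * h x) + c * (LINT x|M. g x * h x)"
  using L2_integrable_mult[OF assms(1,3)] L2_integrable_mult[OF assms(2,3)]
  by (simp add: distrib_right mult.assoc)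

text \<open>
  The quadratic polynomial $t \mapsto \int (f + tg)^2$ is nonnegative, so its discriminant is not
  positive.
\<close>

lemma Cauchy_Schwarz_L2:
  assumes "f \<in> L2 M" "g \<in> L2 M"
  shows "(LINT x|M. f x * g x)\<^sup>2 \<le> (LINT x|M. (f x)\<^sup>2) * (LINT x|M. (g x)\<^sup>2)"
proof -
  define A B C where "A = (LINT x|M. (g x)\<^sup>2)" and "B = (LINT x|M. f x * g x)"
    and "C = (LINT x|M. (f x)\<^sup>2)"
  have *: "0 \<le> C + 2 * t * B + t\<^sup>2 * A" for t
  proof -
    have "0 \<le> (LINT x|M. (f x + t * g x)\<^sup>2)" by simp
    also have "\<dots> = (LINT x|M. (f x)\<^sup>2 + 2 * t * (f x * g x) + t\<^sup>2 * (g x)\<^sup>2)"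
      by (simp add: power2_sum power_mult_distrib algebra_simps)
    also have "\<dots> = C + 2 * t * B + t\<^sup>2 * A"
      using assms L2_integrable_mult[OF assms] unfolding A_def B_def C_def
      by (simp add: L2_integrable_square)
    finally show ?thesis .
  qed
  have A: "0 \<le> A" and C: "0 \<le> C" by (simp_all add: A_def C_def)
  have "B\<^sup>2 \<le> C * A"
  proof (cases "A = 0")
    case True
    have "B = 0"
    proof (rule ccontr)
      assume "B \<noteq> 0"
      then show False
        using *[of "- (C + 1) / (2 * B)"] True by (simp add: field_simps)
    qed
    then show ?thesis using A C by simp
  next
    case False
    then have "C + 2 * (- B / A) * B + (- B / A)\<^sup>2 * A = C - B\<^sup>2 / A"
      by (simp add: field_simps power2_eq_square)
    then have "0 \<le> C - B\<^sup>2 / A"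
      using *[of "- B / A"] by simp
    then show ?thesis
      using False A by (simp add: pos_divide_le_eq)
  qed
  then show ?thesis by (simp add: A_def B_def C_def)
qed

lemma L2_tendsto_lincomb:
  assumes [measurable]: "\<And>n. f n \<in> borel_measurable M" "u \<in> borel_measurable M"
    "\<And>n. g n \<in> borel_measurable M" "v \<in> borel_measurable M"
    and f: "L2_tendsto M f u G" and g: "L2_tendsto M g v G"
  shows "L2_tendsto M (\<lambda>n x. f n x + c * g n x) (\<lambda>x. u x + c * v x) G"
  unfolding L2_tendsto_def
proof (rule tendsto_sandwich[where f = "\<lambda>_. 0"])
  let ?a = "\<lambda>n. \<integral>\<^sup>+x. ennreal ((f n x - u x)\<^sup>2) \<partial>M"
  let ?b = "\<lambda>n. \<integral>\<^sup>+x. ennreal ((g n x - v x)\<^sup>2) \<partial>M"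
  have "((\<lambda>n. ennreal 2 * ?a n + ennreal (2 * c\<^sup>2) * ?b n) \<longlongrightarrow> ennreal 2 * 0 + ennreal (2 * c\<^sup>2) * 0) G"
    using f g unfolding L2_tendsto_def
    by (intro tendsto_add ennreal_tendsto_cmult) auto
  then show "((\<lambda>n. ennreal 2 * ?a n + ennreal (2 * c\<^sup>2) * ?b n) \<longlongrightarrow> 0) G"
    by simp
  have "(a + c * b - (a' + c * b'))\<^sup>2 \<le> 2 * (a - a')\<^sup>2 + 2 * c\<^sup>2 * (b - b')\<^sup>2" for a b a' b' :: real
    using zero_le_power2[of "(a - a') - c * (b - b')"]
    by (simp add: power2_eq_square algebra_simps)
  then have "(\<integral>\<^sup>+x. ennreal ((f n x + c * g n x - (u x + c * v x))\<^sup>2) \<partial>M) \<le>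
    (\<integral>\<^sup>+x. ennreal 2 * ennreal ((f n x - u x)\<^sup>2) + ennreal (2 * c\<^sup>2) * ennreal ((g n x - v x)\<^sup>2) \<partial>M)" for n
    by (intro nn_integral_mono)
      (simp del: ennreal_numeral add: ennreal_leI flip: ennreal_mult ennreal_plus)
  then show "\<forall>\<^sub>F n in G. (\<integral>\<^sup>+x. ennreal ((f n x + c * g n x - (u x + c * v x))\<^sup>2) \<partial>M)
      \<le> ennreal 2 * ?a n + ennreal (2 * c\<^sup>2) * ?b n"
    by (simp add: nn_integral_add nn_integral_cmult)
qed auto

lemma nn_integral_square_L2:
  "f \<in> L2 M \<Longrightarrow> (\<integral>\<^sup>+x. ennreal ((f x)\<^sup>2) \<partial>M) = ennreal (LINT x|M. (f x)\<^sup>2)"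
  by (rule nn_integral_eq_integral) (auto simp: L2_integrable_square)

text \<open>
  The definition of \<open>L2_tendsto\<close> uses the nonnegative integral, which is meaningful for
  arbitrary functions; on \<open>L2\<close> the Bochner integral may be used instead.
\<close>

lemma L2_tendsto_iff_integral:
  assumes "\<And>n. f n \<in> L2 M" "u \<in> L2 M"
  shows "L2_tendsto M f u G \<longleftrightarrow> ((\<lambda>n. LINT x|M. (f n x - u x)\<^sup>2) \<longlongrightarrow> 0) G"
proof -
  have "(\<integral>\<^sup>+x. ennreal ((f n x - u x)\<^sup>2) \<partial>M) = ennreal (LINT x|M. (f n x - u x)\<^sup>2)" for n
    using nn_integral_square_L2[OF L2_diff[OF assms(1)[of n] assms(2)]] .
  then have "L2_tendsto M f u G \<longleftrightarrow> ((\<lambda>n. ennreal (LINT x|M. (f n x - u x)\<^sup>2)) \<longlongrightarrow> ennreal 0) G"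
    by (simp add: L2_tendsto_def)
  also have "\<dots> \<longleftrightarrow> ((\<lambda>n. LINT x|M. (f n x - u x)\<^sup>2) \<longlongrightarrow> 0) G"
    by (rule tendsto_ennreal_iff) auto
  finally show ?thesis .
qed

lemma L2_tendsto_inner:
  assumes f: "\<And>n. f n \<in> L2 M" and u: "u \<in> L2 M" and g: "g \<in> L2 M" and lim: "L2_tendsto M f u G"
  shows "((\<lambda>n. LINT x|M. f n x * g x) \<longlongrightarrow> (LINT x|M. u x * g x)) G"
proof -
  let ?d = "\<lambda>n. LINT x|M. (f n x - u x) * g x"
  have "((\<lambda>n. (LINT x|M. (f n x - u x)\<^sup>2) * (LINT x|M. (g x)\<^sup>2)) \<longlongrightarrow> 0 * (LINT x|M. (g x)\<^sup>2)) G"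
    by (rule tendsto_mult) (use lim L2_tendsto_iff_integral[of f M u G, OF f u] in blast, rule tendsto_const)
  then have "((\<lambda>n. (LINT x|M. (f n x - u x)\<^sup>2) * (LINT x|M. (g x)\<^sup>2)) \<longlongrightarrow> 0) G"
    by simp
  then have "((\<lambda>n. (?d n)\<^sup>2) \<longlongrightarrow> 0) G"
    by (rule tendsto_sandwich[where f = "\<lambda>_. 0", rotated -1])
      (auto intro: always_eventually Cauchy_Schwarz_L2[OF L2_diff[OF f u] g])
  then have "((\<lambda>n. \<bar>?d n\<bar>) \<longlongrightarrow> 0) G"
    using tendsto_real_sqrt[of "\<lambda>n. (?d n)\<^sup>2" 0 G] by simp
  then have "(?d \<longlongrightarrow> 0) G"
    by (rule tendsto_rabs_zero_cancel)
  moreover have "?d n = (LINT x|M. f n x * g x) - (LINT x|M. u x * g x)" for n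
    using L2_integrable_mult[OF f[of n] g] L2_integrable_mult[OF u g] by (simp add: left_diff_distrib)
  ultimately show ?thesis
    by (simp add: LIM_zero_iff)
qed

text \<open>
  The form of the inequality for extended nonnegative functions in which no square root has to
  be taken. Doubling the variable avoids a case distinction on zero and infinite integrals:
  $(h(x)h(y))^2 \le (f(x)g(y))(g(x)f(y))$, so $2h(x)h(y) \le f(x)g(y) + g(x)f(y)$ by the inequality
  between arithmetic and geometric mean, and it remains to integrate over $x$ and $y$.
\<close>

lemma nn_integral_Cauchy_Schwarz:
  fixes f g h :: "'a \<Rightarrow> ennreal"
  assumes [measurable]: "f \<in> borel_measurable M" "g \<in> borel_measurable M" "h \<in> borel_measurable M"
    and le: "\<And>x. (h x)\<^sup>2 \<le> f x * g x"
  shows "(\<integral>\<^sup>+x. h x \<partial>M)\<^sup>2 \<le> (\<integral>\<^sup>+x. f x \<partial>M) * (\<integral>\<^sup>+x. g x \<partial>M)"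
proof -
  have amgm: "2 * p \<le> a + b" if "p\<^sup>2 \<le> a * b" for a b p :: ennreal
  proof (cases a; cases b)
    fix r s assume r: "a = ennreal r" "0 \<le> r" and s: "b = ennreal s" "0 \<le> s"
    have "p \<noteq> top"
    proof
      assume "p = top"
      then have "a * b = top"
        using that by (simp add: power2_eq_square top_unique)
      then show False
        using r s by (simp add: ennreal_mult_eq_top_iff)
    qed
    then obtain q where q: "p = ennreal q" "0 \<le> q"
      by (cases p) auto
    have "q\<^sup>2 \<le> r * s"
      using that r s q by (simp add: ennreal_power flip: ennreal_mult)
    then have "(q + q)\<^sup>2 \<le> (r + s)\<^sup>2"
      using sum_squares_bound[of r s] unfolding power2_sum by (simp only: power2_eq_square)
    then have "q + q \<le> r + s"
      by (rule power2_le_imp_le) (use r s in simp)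
    then have "ennreal (q + q) \<le> ennreal (r + s)" by (rule ennreal_leI)
    then have "ennreal q + ennreal q \<le> ennreal r + ennreal s"
      by (simp only: ennreal_plus[OF q(2) q(2)] ennreal_plus[OF r(2) s(2)])
    then show ?thesis
      unfolding mult_2 r(1) s(1) q(1) .
  qed (simp_all add: top_add add_top)
  \<comment> \<open>the factors are grouped so that each summand separates the two variables\<close>
  have pt: "2 * (h x * h y) \<le> f x * g y + g x * f y" for x y
  proof (rule amgm)
    have "(h x * h y)\<^sup>2 = (h x)\<^sup>2 * (h y)\<^sup>2" by (simp add: power_mult_distrib)
    also have "\<dots> \<le> (f x * g x) * (f y * g y)" by (intro mult_mono le) auto
    finally show "(h x * h y)\<^sup>2 \<le> f x * g y * (g x * f y)" by (simp add: mult_ac)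
  qed
  let ?A = "\<integral>\<^sup>+x. f x \<partial>M" and ?B = "\<integral>\<^sup>+x. g x \<partial>M" and ?H = "\<integral>\<^sup>+x. h x \<partial>M"
  have "2 * ?H\<^sup>2 = (\<integral>\<^sup>+x. (\<integral>\<^sup>+y. 2 * (h x * h y) \<partial>M) \<partial>M)"
    by (simp add: nn_integral_cmult nn_integral_multc power2_eq_square)
  also have "\<dots> \<le> (\<integral>\<^sup>+x. (\<integral>\<^sup>+y. f x * g y + g x * f y \<partial>M) \<partial>M)"
    by (intro nn_integral_mono pt)
  also have "\<dots> = 2 * (?A * ?B)"
    by (simp add: nn_integral_add nn_integral_cmult nn_integral_multc mult.commute[of ?B] flip: mult_2)
  finally show ?thesis
    by (simp add: ennreal_mult_le_mult_iff)
qed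

section \<open>Calculus of $C^1$ functions\<close>

lemma C1_has_derivative: "f \<in> C1 \<Longrightarrow> (f has_derivative frechet_derivative f (at x)) (at x)"
  by (simp add: C1_def flip: frechet_derivative_works)

lemma pd_eqI: "(f has_derivative f') (at x) \<Longrightarrow> pd f i x = f' (axis i 1)"
  by (simp add: pd_def flip: frechet_derivative_at)

lemma C1_I:
  assumes "\<And>x. (f has_derivative f' x) (at x)" "\<And>i. continuous_on UNIV (\<lambda>x. f' x (axis i 1))"
  shows "f \<in> C1"
proof -
  have "pd f i = (\<lambda>x. f' x (axis i 1))" for i
    by (intro ext pd_eqI assms(1))
  then show ?thesis
    using assms by (auto simp: C1_def differentiable_def)
qed

lemma C1_continuous: "f \<in> C1 \<Longrightarrow> continuous_on UNIV f"
  by (simp add: C1_def continuous_at_imp_continuous_on differentiable_imp_continuous_within)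

lemma C1_pd_continuous: "f \<in> C1 \<Longrightarrow> continuous_on UNIV (pd f i)"
  by (simp add: C1_def)

lemma C1_const: "(\<lambda>x. c) \<in> C1"
  by (rule C1_I[where f' = "\<lambda>x h. 0"]) auto

lemma C1_nth: "(\<lambda>x. x $ i) \<in> C1"
  by (rule C1_I[where f' = "\<lambda>x h. h $ i"])
    (auto intro: bounded_linear_imp_has_derivative bounded_linear_vec_nth)

lemma has_derivative_C1_mult:
  assumes "f \<in> C1" "g \<in> C1"
  shows "((\<lambda>x. f x * g x) has_derivative
    (\<lambda>h. f x * frechet_derivative g (at x) h + frechet_derivative f (at x) h * g x)) (at x)"
  by (intro has_derivative_mult C1_has_derivative assms)

lemma pd_mult:
  assumes "f \<in> C1" "g \<in> C1"
  shows "pd (\<lambda>x. f x * g x) i x = f x * pd g i x + pd f i x * g x"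
  by (subst pd_eqI[OF has_derivative_C1_mult[OF assms]]) (simp add: pd_def)

lemma C1_mult:
  assumes "f \<in> C1" "g \<in> C1"
  shows "(\<lambda>x. f x * g x) \<in> C1"
proof (rule C1_I[OF has_derivative_C1_mult[OF assms]])
  show "continuous_on UNIV (\<lambda>x. f x * frechet_derivative g (at x) (axis i 1) +
      frechet_derivative f (at x) (axis i 1) * g x)" for i
    unfolding pd_def[symmetric]
    by (intro continuous_intros C1_continuous C1_pd_continuous assms)
qed

lemma C1_prod: "finite I \<Longrightarrow> (\<And>i. i \<in> I \<Longrightarrow> f i \<in> C1) \<Longrightarrow> (\<lambda>x. \<Prod>i\<in>I. f i x) \<in> C1"
proof (induction I rule: finite_induct)
  case empty
  show ?case by (simp only: prod.empty C1_const)
next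
  case (insert j I)
  have "(\<lambda>x. f j x * (\<Prod>i\<in>I. f i x)) \<in> C1"
    by (rule C1_mult) (use insert in blast)+
  then show ?case
    by (simp only: prod.insert[OF insert(1,2)])
qed

lemma C1_lincomb:
  assumes "f \<in> C1" "g \<in> C1"
  shows "(\<lambda>x. f x + c * g x) \<in> C1"
proof (rule C1_I)
  show "((\<lambda>x. f x + c * g x) has_derivative
      (\<lambda>h. frechet_derivative f (at x) h + c * frechet_derivative g (at x) h)) (at x)" for x
    by (intro has_derivative_add has_derivative_mult_right C1_has_derivative assms)
  show "continuous_on UNIV (\<lambda>x. frechet_derivative f (at x) (axis i 1) + c * frechet_derivative g (at x) (axis i 1))" for i
    unfolding pd_def[symmetric]
    by (intro continuous_intros C1_pd_continuous assms)
qed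

lemma C1_compose:
  assumes f: "f \<in> C1" and \<eta>: "\<And>t. (\<eta> has_real_derivative \<eta>' t) (at t)" "continuous_on UNIV \<eta>'"
  shows "(\<lambda>x. \<eta> (f x)) \<in> C1"
proof (rule C1_I)
  show "((\<lambda>x. \<eta> (f x)) has_derivative (\<lambda>h. \<eta>' (f x) * frechet_derivative f (at x) h)) (at x)" for x
    using has_derivative_compose[OF C1_has_derivative[OF f], where g = \<eta> and g' = "\<lambda>h. \<eta>' (f x) * h"]
      \<eta>(1)[of "f x"]
    by (simp add: has_field_derivative_def)
  show "continuous_on UNIV (\<lambda>x. \<eta>' (f x) * frechet_derivative f (at x) (axis i 1))" for i
    unfolding pd_def[symmetric]
    by (intro continuous_intros C1_pd_continuous f continuous_on_compose2[OF \<eta>(2) C1_continuous]) auto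
qed

text \<open>
  Along a coordinate line a partial derivative is an ordinary derivative, which makes the mean
  value theorem and the fundamental theorem of calculus available.
\<close>

lemma pd_line:
  assumes "f \<in> C1"
  shows "((\<lambda>t. f (x + t *\<^sub>R axis i 1)) has_real_derivative pd f i (x + t *\<^sub>R axis i 1)) (at t)"
proof -
  let ?y = "x + t *\<^sub>R axis i 1"
  have d: "((\<lambda>t. x + t *\<^sub>R axis i 1) has_derivative (\<lambda>h. h *\<^sub>R axis i 1)) (at t)"
    by (auto intro!: derivative_eq_intros)
  have "((\<lambda>t. f (x + t *\<^sub>R axis i 1)) has_derivative
      (\<lambda>h. frechet_derivative f (at ?y) (h *\<^sub>R axis i 1))) (at t)"
    by (rule has_derivative_compose[OF d C1_has_derivative[OF assms]])
  moreover have "frechet_derivative f (at ?y) (h *\<^sub>R axis i 1) = pd f i ?y * h" for h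
    using linear_frechet_derivative[of f "at ?y"] assms
    by (simp add: C1_def pd_def linear_cmul)
  ultimately show ?thesis
    by (simp add: has_field_derivative_def mult_commute_abs)
qed

lemma pd_eq_0_off_support:
  assumes "closed K" "\<And>x. x \<notin> K \<Longrightarrow> f x = 0" "x \<notin> K"
  shows "pd f i x = 0"
proof -
  have "(f has_derivative (\<lambda>h. 0)) (at x)"
    by (rule has_derivative_transform_within_open[where f = "\<lambda>x. 0" and s = "- K"])
      (use assms in \<open>auto simp: open_Compl\<close>)
  then show ?thesis
    by (simp add: pd_eqI)
qed

lemma integrable_compact_support:
  fixes f :: "real^'n \<Rightarrow> real"
  assumes "continuous_on UNIV f" "compact K" "\<And>x. x \<notin> K \<Longrightarrow> f x = 0"
  shows "integrable lborel f"
proof -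
  have "integrable lborel (\<lambda>x. indicator K x *\<^sub>R f x)"
    using assms by (intro borel_integrable_compact) (auto intro: continuous_on_subset)
  moreover have "(\<lambda>x. indicator K x *\<^sub>R f x) = f"
    using assms(3) by (auto simp: indicator_def fun_eq_iff)
  ultimately show ?thesis by simp
qed

lemma borel_lebesgue_on: "f \<in> borel_measurable borel \<Longrightarrow> f \<in> borel_measurable (lebesgue_on \<Omega>)"
  by (intro measurable_restrict_space1 measurable_completion) simp

text \<open>
  These facts move the integrals of test functions from \<open>\<Omega>\<close> to the whole space, where
  translations and product measures are available.
\<close>

lemma
  fixes f :: "real^'n \<Rightarrow> real"
  assumes \<Omega>: "\<Omega> \<in> sets lebesgue" and [measurable]: "f \<in> borel_measurable borel"
    and 0: "\<And>x. x \<notin> \<Omega> \<Longrightarrow> f x = 0"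
  shows integral_lebesgue_on_borel: "(LINT x|lebesgue_on \<Omega>. f x) = (LINT x|lborel. f x)"
    and integrable_lebesgue_on_borel: "integrable (lebesgue_on \<Omega>) f \<longleftrightarrow> integrable lborel f"
proof -
  have eq: "(\<lambda>x. indicator \<Omega> x *\<^sub>R f x) = f"
    using 0 by (auto simp: indicator_def fun_eq_iff)
  show "(LINT x|lebesgue_on \<Omega>. f x) = (LINT x|lborel. f x)"
    using \<Omega> integral_completion[of f lborel] by (subst integral_restrict_space) (auto simp: eq simp del: real_scaleR_def)
  show "integrable (lebesgue_on \<Omega>) f \<longleftrightarrow> integrable lborel f"
    using \<Omega> by (subst integrable_restrict_space) (auto simp: eq integrable_completion simp del: real_scaleR_def)
qed

lemma C1c_mult: "f \<in> C1 \<Longrightarrow> \<phi> \<in> C1c \<Omega> \<Longrightarrow> (\<lambda>x. f x * \<phi> x) \<in> C1c \<Omega>"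
  unfolding C1c_def mem_Collect_eq using C1_mult by (metis mult_zero_right)

text \<open>
  By translation invariance all difference quotients of \<open>f\<close> in direction \<open>i\<close> have integral zero.
  They converge to the partial derivative and, by the mean value theorem, are bounded by its
  maximum on a fixed ball, so dominated convergence applies.
\<close>

lemma integral_pd_eq_0:
  fixes f :: "real^'n \<Rightarrow> real"
  assumes f: "f \<in> C1" and K: "compact K" "\<And>x. x \<notin> K \<Longrightarrow> f x = 0"
  shows "(LINT x|lborel. pd f i x) = 0"
proof -
  let ?e = "axis i 1 :: real^'n"
  define h where "h n = 1 / real (Suc n)" for n
  define D where "D n x = (f (x + h n *\<^sub>R ?e) - f x) / h n" for n x
  have h: "0 < h n" "h n \<le> 1" for n by (simp_all add: h_def)
  have cf[measurable]: "f \<in> borel_measurable borel" "pd f i \<in> borel_measurable borel"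
    using f by (auto intro!: borel_measurable_continuous_onI C1_continuous C1_pd_continuous)
  have int: "integrable lborel f"
    by (rule integrable_compact_support[OF C1_continuous[OF f] K])
  have tr: "integrable lborel (\<lambda>x. f (x + c))" "(LINT x|lborel. f (x + c)) = (LINT x|lborel. f x)" for c
  proof -
    have "integrable (distr lborel borel ((+) c)) f"
      using int by (simp add: lborel_distr_plus)
    then show "integrable lborel (\<lambda>x. f (x + c))"
      by (simp add: integrable_distr_eq add.commute)
    have "(LINT x|lborel. f x) = (LINT x|distr lborel borel ((+) c). f x)"
      by (simp add: lborel_distr_plus)
    also have "\<dots> = (LINT x|lborel. f (c + x))"
      by (rule integral_distr) auto
    finally show "(LINT x|lborel. f (x + c)) = (LINT x|lborel. f x)"
      by (simp add: add.commute)
  qed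
  have D0: "(LINT x|lborel. D n x) = 0" for n
    unfolding D_def
    by (simp only: integral_divide_zero Bochner_Integration.integral_diff[OF tr(1) int] tr(2) diff_self div_0)
  obtain R where R: "K \<subseteq> cball 0 R"
  proof -
    have "bounded K" by (rule compact_imp_bounded[OF K(1)])
    then obtain R where "\<And>x. x \<in> K \<Longrightarrow> norm x \<le> R" by (auto simp: bounded_iff)
    then have "K \<subseteq> cball 0 R" by auto
    then show ?thesis by (rule that)
  qed
  obtain B where B: "\<And>x. \<bar>pd f i x\<bar> \<le> B"
  proof -
    have "bounded (pd f i ` K)"
      by (intro compact_imp_bounded compact_continuous_image continuous_on_subset[OF C1_pd_continuous[OF f]] K) auto
    then obtain B where "\<And>x. x \<in> K \<Longrightarrow> \<bar>pd f i x\<bar> \<le> B"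
      by (auto simp: bounded_iff)
    then have "\<bar>pd f i x\<bar> \<le> max B 0" for x
      using pd_eq_0_off_support[OF compact_imp_closed[OF K(1)] K(2), where x = x and i = i] by (cases "x \<in> K") force+
    then show ?thesis by (rule that)
  qed
  have "(\<lambda>n. LINT x|lborel. D n x) \<longlonglongrightarrow> (LINT x|lborel. pd f i x)"
  proof (rule integral_dominated_convergence[where w = "\<lambda>x. B * indicator (cball 0 (R + 1)) x"])
    show "integrable lborel (\<lambda>x. B * indicator (cball 0 (R + 1)) x)"
      using emeasure_bounded_finite[OF bounded_cball, of 0 "R + 1"]
      by (intro integrable_mult_right integrable_real_indicator) auto
    have "(\<lambda>n. D n x) \<longlonglongrightarrow> pd f i x" for x
    proof -
      have "((\<lambda>t. (f (x + t *\<^sub>R ?e) - f x) / t) \<longlongrightarrow> pd f i x) (at 0)"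
        using pd_line[OF f, of x i 0] by (simp add: has_field_derivative_iff)
      moreover have "filterlim h (at 0) sequentially"
        unfolding filterlim_at using h(1) LIMSEQ_inverse_real_of_nat
        by (auto simp: h_def[abs_def] inverse_eq_divide less_imp_neq[symmetric])
      ultimately show ?thesis
        unfolding D_def by (rule filterlim_compose)
    qed
    then show "AE x in lborel. (\<lambda>n. D n x) \<longlonglongrightarrow> pd f i x" by simp
    have "\<bar>D n x\<bar> \<le> B * indicator (cball 0 (R + 1)) x" for n x
    proof (cases "x \<in> cball 0 (R + 1)")
      case True
      obtain z where "f (x + h n *\<^sub>R ?e) - f (x + 0 *\<^sub>R ?e) = (h n - 0) * pd f i (x + z *\<^sub>R ?e)"
        using MVT2[of 0 "h n" "\<lambda>t. f (x + t *\<^sub>R ?e)" "\<lambda>t. pd f i (x + t *\<^sub>R ?e)"] pd_line[OF f] h(1)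
        by blast
      then have "D n x = pd f i (x + z *\<^sub>R ?e)"
        using h(1)[of n] by (simp add: D_def)
      then show ?thesis
        using True B by simp
    next
      case False
      have "x + h n *\<^sub>R ?e \<notin> K"
      proof
        assume "x + h n *\<^sub>R ?e \<in> K"
        then have "norm (x + h n *\<^sub>R ?e) \<le> R" using R by auto
        moreover have "norm x \<le> norm (x + h n *\<^sub>R ?e) + norm (h n *\<^sub>R ?e)"
          using norm_triangle_sub[of x "x + h n *\<^sub>R ?e"] by (simp add: norm_minus_commute)
        ultimately show False
          using False h[of n] by (simp add: norm_axis_1)
      qed
      moreover have "x \<notin> K" using False R by auto
      ultimately show ?thesis
        using False K(2) by (simp add: D_def)
    qed
    then show "\<And>n. AE x in lborel. norm (D n x) \<le> B * indicator (cball 0 (R + 1)) x" by simp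
  qed (simp_all add: D_def[abs_def])
  then show ?thesis
    using D0 by (simp add: LIMSEQ_const_iff)
qed

section \<open>Test functions and smooth approximation of boxes\<close>

lemma C1c_continuous: "\<phi> \<in> C1c \<Omega> \<Longrightarrow> continuous_on UNIV \<phi>"
  by (simp add: C1c_def C1_continuous)

lemma C1c_eq_0: "\<phi> \<in> C1c \<Omega> \<Longrightarrow> x \<notin> \<Omega> \<Longrightarrow> \<phi> x = 0"
  by (auto simp: C1c_def)

lemma pd_C1c_eq_0: "\<phi> \<in> C1c \<Omega> \<Longrightarrow> x \<notin> \<Omega> \<Longrightarrow> pd \<phi> i x = 0"
  unfolding C1c_def by (blast intro: pd_eq_0_off_support compact_imp_closed)

lemma C1c_pd_continuous: "\<phi> \<in> C1c \<Omega> \<Longrightarrow> continuous_on UNIV (pd \<phi> i)"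
  by (simp add: C1c_def C1_pd_continuous)

lemma continuous_L2:
  fixes f :: "real^'n \<Rightarrow> real"
  assumes "open \<Omega>" "continuous_on UNIV f" and K: "compact K" "K \<subseteq> \<Omega>" "\<And>x. x \<notin> K \<Longrightarrow> f x = 0"
  shows "f \<in> L2 (lebesgue_on \<Omega>)"
proof -
  have [measurable]: "f \<in> borel_measurable borel"
    by (rule borel_measurable_continuous_onI[OF assms(2)])
  have "integrable lborel (\<lambda>x. (f x)\<^sup>2)"
    by (rule integrable_compact_support[OF _ K(1)]) (use K(3) assms(2) in \<open>auto intro!: continuous_intros\<close>)
  moreover have "\<Omega> \<in> sets lebesgue" using assms(1) by (simp add: borel_open)
  ultimately have "integrable (lebesgue_on \<Omega>) (\<lambda>x. (f x)\<^sup>2)"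
    using K(2,3) by (subst integrable_lebesgue_on_borel) auto
  then show ?thesis
    by (simp add: L2_def borel_lebesgue_on)
qed

lemma C1c_L2:
  assumes "open \<Omega>" "\<phi> \<in> C1c \<Omega>"
  shows "\<phi> \<in> L2 (lebesgue_on \<Omega>)"
proof -
  obtain K where "compact K" "K \<subseteq> \<Omega>" "\<And>x. x \<notin> K \<Longrightarrow> \<phi> x = 0"
    using assms(2) by (auto simp: C1c_def)
  then show ?thesis
    by (intro continuous_L2[OF assms(1) C1c_continuous[OF assms(2)]])
qed

lemma pd_C1c_L2:
  assumes "open \<Omega>" "\<phi> \<in> C1c \<Omega>"
  shows "pd \<phi> i \<in> L2 (lebesgue_on \<Omega>)"
proof -
  obtain K where "compact K" "K \<subseteq> \<Omega>" "\<And>x. x \<notin> K \<Longrightarrow> \<phi> x = 0"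
    using assms(2) by (auto simp: C1c_def)
  then show ?thesis
    by (intro continuous_L2[OF assms(1) C1c_pd_continuous[OF assms(2)]] pd_eq_0_off_support[of K])
      (auto simp: compact_imp_closed)
qed

text \<open>
  The product of two test functions is a test function, and its partial derivative integrates
  to zero.
\<close>

lemma has_weak_partial_C1c:
  assumes \<Omega>: "open \<Omega>" and \<phi>: "\<phi> \<in> C1c \<Omega>"
  shows "has_weak_partial \<Omega> \<phi> i (pd \<phi> i)"
  unfolding has_weak_partial_def
proof (intro conjI ballI pd_C1c_L2[OF \<Omega> \<phi>])
  fix \<psi> assume \<psi>: "\<psi> \<in> C1c \<Omega>"
  have C1: "\<phi> \<in> C1" "\<psi> \<in> C1" using \<phi> \<psi> by (auto simp: C1c_def)
  have "(\<lambda>x. \<phi> x * \<psi> x) \<in> C1c \<Omega>"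
    using C1c_mult[OF C1(1) \<psi>] .
  then obtain K where K: "compact K" "K \<subseteq> \<Omega>" "\<And>x. x \<notin> K \<Longrightarrow> \<phi> x * \<psi> x = 0"
    by (auto simp: C1c_def)
  have meas: "\<Omega> \<in> sets lebesgue" using \<Omega> by (simp add: borel_open)
  have "0 = (LINT x|lborel. pd (\<lambda>x. \<phi> x * \<psi> x) i x)"
    by (rule integral_pd_eq_0[OF C1_mult[OF C1] K(1,3), symmetric])
  also have "\<dots> = (LINT x|lebesgue_on \<Omega>. pd (\<lambda>x. \<phi> x * \<psi> x) i x)"
    by (intro integral_lebesgue_on_borel[symmetric] meas borel_measurable_continuous_onI
        C1_pd_continuous C1_mult C1 pd_C1c_eq_0[OF C1c_mult[OF C1(1) \<psi>]])
  also have "\<dots> = (LINT x|lebesgue_on \<Omega>. \<phi> x * pd \<psi> i x + pd \<phi> i x * \<psi> x)"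
    by (simp only: pd_mult[OF C1])
  also have "\<dots> = l2_inner \<Omega> \<phi> (pd \<psi> i) + l2_inner \<Omega> (pd \<phi> i) \<psi>"
    unfolding l2_inner_def inner_real_def
    by (intro Bochner_Integration.integral_add L2_integrable_mult C1c_L2 pd_C1c_L2 \<Omega> \<phi> \<psi>)
  finally show "l2_inner \<Omega> \<phi> (pd \<psi> i) = - l2_inner \<Omega> (pd \<phi> i) \<psi>"
    by simp
qed

text \<open>
  The measures with densities $f^+$ and $f^-$ agree on boxes, which form an intersection-stable
  generator of the Borel sets; hence they are equal, and so are their densities.
\<close>

lemma AE_eq_0_if_box_integrals_eq_0:
  fixes f :: "'a::euclidean_space \<Rightarrow> real"
  assumes f: "integrable lborel f"
    and box: "\<And>a b. (LINT x|lborel. indicator (box a b) x * f x) = 0"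
  shows "AE x in lborel. f x = 0"
proof -
  have [measurable]: "f \<in> borel_measurable borel" using f by auto
  let ?p = "\<lambda>x. ennreal (f x)" and ?q = "\<lambda>x. ennreal (- f x)"
  have inj: "x = y" if "enn2real x = enn2real y" "x \<noteq> \<infinity>" "y \<noteq> \<infinity>" for x y
    using that by (cases x; cases y) auto
  have emb: "emeasure (density lborel ?p) (box a b) = emeasure (density lborel ?q) (box a b)"
    and fin: "emeasure (density lborel ?p) (box a b) \<noteq> \<infinity>" for a b
  proof -
    let ?g = "\<lambda>x. indicator (box a b) x * f x"
    have g: "integrable lborel ?g"
      using integrable_mult_indicator[OF _ f, of "box a b"] by simp
    have P: "emeasure (density lborel ?p) (box a b) = (\<integral>\<^sup>+x. ennreal (?g x) \<partial>lborel)"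
      by (subst emeasure_density) (auto intro!: nn_integral_cong simp: indicator_def)
    have Q: "emeasure (density lborel ?q) (box a b) = (\<integral>\<^sup>+x. ennreal (- ?g x) \<partial>lborel)"
      by (subst emeasure_density) (auto intro!: nn_integral_cong simp: indicator_def)
    show "emeasure (density lborel ?p) (box a b) \<noteq> \<infinity>"
      unfolding P by (rule g[unfolded real_integrable_def, THEN conjunct2, THEN conjunct1])
    have "enn2real (\<integral>\<^sup>+x. ennreal (?g x) \<partial>lborel) = enn2real (\<integral>\<^sup>+x. ennreal (- ?g x) \<partial>lborel)"
      using real_lebesgue_integral_def[OF g] box[of a b] by simp
    moreover have "(\<integral>\<^sup>+x. ennreal (?g x) \<partial>lborel) \<noteq> \<infinity>" "(\<integral>\<^sup>+x. ennreal (- ?g x) \<partial>lborel) \<noteq> \<infinity>"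
      by (rule g[unfolded real_integrable_def, THEN conjunct2, THEN conjunct1],
          rule g[unfolded real_integrable_def, THEN conjunct2, THEN conjunct2])
    ultimately show "emeasure (density lborel ?p) (box a b) = emeasure (density lborel ?q) (box a b)"
      unfolding P Q by (rule inj)
  qed
  have "density lborel ?p = density lborel ?q"
  proof (rule measure_eqI_generator_eq)
    let ?E = "range (\<lambda>(a, b). box a b::'a set)"
    show "Int_stable ?E"
      by (auto simp: Int_stable_def box_Int_box)
    show "?E \<subseteq> Pow UNIV" "sets (density lborel ?p) = sigma_sets UNIV ?E"
      "sets (density lborel ?q) = sigma_sets UNIV ?E"
      by (simp_all add: borel_eq_box)
    let ?A = "\<lambda>n::nat. box (- (real n *\<^sub>R One)) (real n *\<^sub>R One) :: 'a set"
    show "range ?A \<subseteq> ?E" "(\<Union>i. ?A i) = UNIV"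
      unfolding UN_box_eq_UNIV by auto
    show "emeasure (density lborel ?p) (?A i) \<noteq> \<infinity>" for i by (rule fin)
    show "emeasure (density lborel ?p) X = emeasure (density lborel ?q) X" if "X \<in> ?E" for X
      using that emb by auto
  qed
  then have "AE x in lborel. ?p x = ?q x"
    by (intro sigma_finite_measure.density_unique_iff[OF sigma_finite_lborel, THEN iffD1]) auto
  then show ?thesis
  proof eventually_elim
    case (elim x)
    have "ennreal (f x) = 0 \<or> ennreal (- f x) = 0"
      by (cases "f x \<le> 0") (auto simp: ennreal_neg)
    then have "ennreal (f x) = 0" "ennreal (- f x) = 0"
      using elim by auto
    then show "f x = 0"
      by (simp add: ennreal_eq_0_iff)
  qed
qed

text \<open>
  Let $m(s) = \max(0,s)^2$ and $p(x) = \prod_i m((x_i - a_i)(b_i - x_i))$: this is a $C^1$ function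
  that is nonzero exactly on the box. The functions $\frac{k p^2}{1 + k p^2}$ are then again $C^1$,
  lie between $0$ and the indicator of the box, and tend to that indicator.
\<close>

lemma box_indicator_limit_C1c:
  fixes a b :: "real^'n"
  assumes ab: "\<And>i. a $ i < b $ i" and sub: "cbox a b \<subseteq> \<Omega>"
  obtains \<phi> where "\<And>k. \<phi> k \<in> C1c \<Omega>" "\<And>k x. \<bar>\<phi> k x\<bar> \<le> indicator (box a b) x"
    "\<And>x. (\<lambda>k. \<phi> k x) \<longlonglongrightarrow> indicator (box a b) x"
proof -
  define m :: "real \<Rightarrow> real" where "m s = (max 0 s)\<^sup>2" for s
  define \<eta> :: "nat \<Rightarrow> real \<Rightarrow> real" where "\<eta> k t = real k * t\<^sup>2 / (1 + real k * t\<^sup>2)" for k t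
  define p where "p x = (\<Prod>i\<in>UNIV. m ((x $ i - a $ i) * (b $ i - x $ i)))" for x
  define \<phi> where "\<phi> k x = \<eta> k (p x)" for k x
  have m': "(m has_real_derivative 2 * max 0 s) (at s)" for s
  proof -
    \<comment> \<open>differentiability at zero is where the square in \<open>m\<close> is needed\<close>
    consider "s < 0" | "s > 0" | "s = 0" by linarith
    then show ?thesis
    proof cases
      case 1
      have "((\<lambda>s. 0) has_real_derivative 2 * max 0 s) (at s)"
        using 1 by simp
      then show ?thesis
        by (rule has_field_derivative_transform_within_open[where S = "{..<0}"]) (use 1 in \<open>auto simp: m_def\<close>)
    next
      case 2
      have "((\<lambda>s. s\<^sup>2) has_real_derivative 2 * max 0 s) (at s)"
        using 2 by (auto intro!: derivative_eq_intros)
      then show ?thesis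
        by (rule has_field_derivative_transform_within_open[where S = "{0<..}"]) (use 2 in \<open>auto simp: m_def\<close>)
    next
      case 3
      have "((\<lambda>h. (m (0 + h) - m 0) / h) \<longlongrightarrow> 0) (at 0)"
      proof (rule tendsto_rabs_zero_cancel, rule tendsto_sandwich[where f = "\<lambda>_. 0" and h = "\<lambda>h. \<bar>h\<bar>"])
        have "\<bar>(m (0 + h) - m 0) / h\<bar> \<le> \<bar>h\<bar>" for h
          by (cases "h > 0") (auto simp: m_def power2_eq_square)
        then show "\<forall>\<^sub>F h in at 0. \<bar>(m (0 + h) - m 0) / h\<bar> \<le> \<bar>h\<bar>" by simp
        show "((\<lambda>h::real. \<bar>h\<bar>) \<longlongrightarrow> 0) (at 0)"
          by (auto intro!: tendsto_eq_intros)
      qed auto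
      then show ?thesis
        using 3 by (simp add: has_field_derivative_iff)
    qed
  qed
  have "(\<lambda>x. (x $ i - a $ i) * (b $ i - x $ i)) \<in> C1" for i
  proof -
    have "(\<lambda>x::real^'n. (- a $ i) + 1 * x $ i) \<in> C1" "(\<lambda>x::real^'n. b $ i + (- 1) * x $ i) \<in> C1"
      by (intro C1_lincomb C1_const C1_nth)+
    from C1_mult[OF this] show ?thesis by simp
  qed
  then have "p \<in> C1"
    unfolding p_def[abs_def]
    by (intro C1_prod C1_compose[where \<eta> = m and \<eta>' = "\<lambda>s. 2 * max 0 s"] m' continuous_intros) auto
  moreover have pos: "1 + real k * t\<^sup>2 > 0" for k t
    by (rule add_pos_nonneg) auto
  then have ne: "1 + real k * t\<^sup>2 \<noteq> 0" for k t
    by (metis less_irrefl)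
  have "(\<eta> k has_real_derivative (2 * real k * t) / (1 + real k * t\<^sup>2)\<^sup>2) (at t)" for k t
    unfolding \<eta>_def[abs_def] using ne[of k t]
    by (auto intro!: derivative_eq_intros simp: power2_eq_square field_simps)
  ultimately have "\<phi> k \<in> C1" for k
    unfolding \<phi>_def[abs_def]
    by (rule C1_compose) (use ne in \<open>auto intro!: continuous_intros\<close>)
  moreover have p0: "p x \<noteq> 0 \<longleftrightarrow> x \<in> box a b" for x
  proof -
    have "m ((x $ i - a $ i) * (b $ i - x $ i)) \<noteq> 0 \<longleftrightarrow> a $ i < x $ i \<and> x $ i < b $ i" for i
    proof -
      have "m s \<noteq> 0 \<longleftrightarrow> 0 < s" for s by (auto simp: m_def max_def)
      then have "m ((x $ i - a $ i) * (b $ i - x $ i)) \<noteq> 0 \<longleftrightarrow> 0 < (x $ i - a $ i) * (b $ i - x $ i)" .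
      then show ?thesis
        using ab[of i] unfolding zero_less_mult_iff by linarith
    qed
    then show ?thesis
      unfolding p_def mem_box_cart by (auto simp: prod_zero_iff)
  qed
  ultimately have "\<phi> k \<in> C1c \<Omega>" for k
    unfolding C1c_def using sub box_subset_cbox[of a b]
    by (auto intro!: exI[of _ "cbox a b"] simp: \<phi>_def \<eta>_def)
  moreover have "\<bar>\<phi> k x\<bar> \<le> indicator (box a b) x" for k x
  proof (cases "x \<in> box a b")
    case True
    then show ?thesis
      using pos[of k "p x"] by (simp add: \<phi>_def \<eta>_def abs_mult)
  next
    case False
    then show ?thesis using p0[of x] by (simp add: \<phi>_def \<eta>_def)
  qed
  moreover have "(\<lambda>k. \<phi> k x) \<longlonglongrightarrow> indicator (box a b) x" for x
  proof (cases "x \<in> box a b")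
    case True
    then have t: "(p x)\<^sup>2 > 0" using p0[of x] by simp
    have "filterlim (\<lambda>k. 1 + real k * (p x)\<^sup>2) at_top sequentially"
      by (intro filterlim_tendsto_add_at_top[OF tendsto_const]
          filterlim_at_top_mult_tendsto_pos[OF tendsto_const t] filterlim_real_sequentially)
    then have "(\<lambda>k. 1 - 1 / (1 + real k * (p x)\<^sup>2)) \<longlonglongrightarrow> 1 - 0"
      by (intro tendsto_diff tendsto_const tendsto_divide_0) (auto intro: filterlim_at_top_imp_at_infinity)
    moreover have "1 - 1 / (1 + real k * (p x)\<^sup>2) = \<phi> k x" for k
      using ne[of k "p x"] by (simp add: \<phi>_def \<eta>_def field_simps)
    ultimately show ?thesis using True by simp
  next
    case False
    then show ?thesis using p0[of x] by (simp add: \<phi>_def \<eta>_def)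
  qed
  ultimately show ?thesis by (rule that)
qed

section \<open>The fundamental lemma of the calculus of variations\<close>

lemma open_lebesgue_sets: "open \<Omega> \<Longrightarrow> \<Omega> \<in> sets lebesgue"
  by (simp add: borel_open)

lemma indicator_box_L2:
  "open \<Omega> \<Longrightarrow> indicator (box a b) \<in> L2 (lebesgue_on (\<Omega> :: (real^'n) set))"
proof -
  assume \<Omega>: "open \<Omega>"
  have "integrable lebesgue (\<lambda>x. indicator (\<Omega> \<inter> box a b) x :: real)"
    unfolding lmeasurable_iff_integrable[symmetric]
    by (intro bounded_set_imp_lmeasurable sets.Int open_lebesgue_sets \<Omega> open_box bounded_Int disjI2 bounded_box)
  then have "integrable (lebesgue_on \<Omega>) (indicator (box a b) :: _ \<Rightarrow> real)"
    using open_lebesgue_sets[OF \<Omega>] by (subst integrable_restrict_space) (auto simp: indicator_inter_arith)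
  moreover have "(\<lambda>x. (indicator (box a b) x)\<^sup>2) = (indicator (box a b) :: _ \<Rightarrow> real)"
    by (auto simp: indicator_def)
  ultimately show ?thesis
    unfolding L2_def by (simp add: borel_lebesgue_on)
qed

text \<open>
  The test functions approximate the indicators of boxes, so \<open>v\<close> has integral zero over every
  box whose closure lies in \<open>\<Omega>\<close>. Subboxes of such a box are of the same kind, so \<open>v\<close> vanishes
  almost everywhere in it, and countably many such boxes cover \<open>\<Omega>\<close>.
\<close>

lemma AE_eq_0_if_orthogonal_C1c:
  fixes \<Omega> :: "(real^'n) set"
  assumes \<Omega>: "open \<Omega>" and v: "v \<in> L2 (lebesgue_on \<Omega>)"
    and orth: "\<And>\<phi>. \<phi> \<in> C1c \<Omega> \<Longrightarrow> (LINT x|lebesgue_on \<Omega>. v x * \<phi> x) = 0"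
  shows "AE x in lebesgue_on \<Omega>. v x = 0"
proof -
  have meas: "\<Omega> \<in> sets lebesgue" by (rule open_lebesgue_sets[OF \<Omega>])
  have vi: "integrable (lebesgue_on \<Omega>) (\<lambda>x. v x * indicator (box a b) x)" for a b
    by (rule L2_integrable_mult[OF v indicator_box_L2[OF \<Omega>]])
  have box0: "(LINT x|lebesgue_on \<Omega>. v x * indicator (box a b) x) = 0" if sub: "cbox a b \<subseteq> \<Omega>" for a b
  proof (cases "\<forall>i. a $ i < b $ i")
    case True
    then obtain \<phi> where \<phi>: "\<And>k. \<phi> k \<in> C1c \<Omega>" "\<And>k x. \<bar>\<phi> k x\<bar> \<le> indicator (box a b) x"
      "\<And>x. (\<lambda>k. \<phi> k x) \<longlonglongrightarrow> indicator (box a b) x"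
      using box_indicator_limit_C1c[OF _ sub] by blast
    have "(\<lambda>k. LINT x|lebesgue_on \<Omega>. v x * \<phi> k x) \<longlonglongrightarrow> (LINT x|lebesgue_on \<Omega>. v x * indicator (box a b) x)"
    proof (rule integral_dominated_convergence[where w = "\<lambda>x. \<bar>v x * indicator (box a b) x\<bar>"])
      show "integrable (lebesgue_on \<Omega>) (\<lambda>x. \<bar>v x * indicator (box a b) x\<bar>)"
        using vi by (rule integrable_abs)
      show "(\<lambda>x. v x * \<phi> k x) \<in> borel_measurable (lebesgue_on \<Omega>)" for k
        using L2_integrable_mult[OF v C1c_L2[OF \<Omega> \<phi>(1)[of k]]] by (rule borel_measurable_integrable)
      show "(\<lambda>x. v x * indicator (box a b) x) \<in> borel_measurable (lebesgue_on \<Omega>)"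
        using vi by (rule borel_measurable_integrable)
      show "AE x in lebesgue_on \<Omega>. (\<lambda>k. v x * \<phi> k x) \<longlonglongrightarrow> v x * indicator (box a b) x"
        by (intro AE_I2 tendsto_mult tendsto_const \<phi>(3))
      show "AE x in lebesgue_on \<Omega>. norm (v x * \<phi> k x) \<le> \<bar>v x * indicator (box a b) x\<bar>" for k
        by (intro AE_I2) (simp add: abs_mult mult_left_mono \<phi>(2))
    qed
    then show ?thesis
      by (simp add: orth[OF \<phi>(1)] LIMSEQ_const_iff)
  next
    case False
    then have "box a b = {}"
      by (simp add: interval_eq_empty_cart not_less)
    then show ?thesis by simp
  qed
  have ae_box: "AE x in lebesgue. x \<in> box a b \<longrightarrow> v x = 0" if sub: "cbox a b \<subseteq> \<Omega>" for a b
  proof -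
    define g where "g x = indicator (box a b) x * v x" for x
    have ext: "(LINT x|lebesgue. indicator (box c d) x * g x) = 0" for c d
    proof -
      obtain e f where ef: "box c d \<inter> box a b = box e f"
        using box_Int_box by blast
      \<comment> \<open>the corners of an empty intersection may lie anywhere, so the box is assumed nonempty\<close>
      have sub': "cbox e' f' \<subseteq> \<Omega>" if "box c d \<inter> box a b = box e' f'" "\<And>i. e' $ i < f' $ i" for e' f'
      proof -
        have "box e' f' \<noteq> {}"
          using that(2) by (simp add: interval_ne_empty_cart)
        then have "cbox e' f' = closure (box e' f')" by simp
        also have "\<dots> \<subseteq> closure (box a b)"
          by (rule closure_mono) (use that(1) in blast)
        also have "\<dots> \<subseteq> cbox a b"
          by (rule closure_minimal[OF box_subset_cbox closed_cbox])
        finally show ?thesis using sub by blast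
      qed
      have "(LINT x|lebesgue. indicator (box c d) x * g x) =
          (LINT x|lebesgue. indicator \<Omega> x *\<^sub>R (v x * indicator (box e f) x))"
        using sub box_subset_cbox[of a b] ef
        by (intro Bochner_Integration.integral_cong) (auto simp: g_def indicator_def)
      also have "\<dots> = (LINT x|lebesgue_on \<Omega>. v x * indicator (box e f) x)"
        using meas by (subst integral_restrict_space) auto
      also have "\<dots> = 0"
      proof (cases "\<forall>i. e $ i < f $ i")
        case True
        then show ?thesis using box0 sub'[OF ef] by blast
      next
        case False
        then have "box e f = {}"
          by (simp add: interval_eq_empty_cart not_less)
        then show ?thesis by simp
      qed
      finally show ?thesis .
    qed
    have "(\<lambda>x. indicator \<Omega> x *\<^sub>R (v x * indicator (box a b) x)) = g"
      using sub box_subset_cbox[of a b] by (auto simp: g_def indicator_def fun_eq_iff)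
    then have g: "integrable lebesgue g"
      using vi[of a b] meas by (subst (asm) integrable_restrict_space) auto
    then obtain g' where g'[measurable]: "g' \<in> borel_measurable lborel" and eq: "AE x in lborel. g x = g' x"
      using completion_ex_borel_measurable_real[of g lborel] by (auto dest: borel_measurable_integrable)
    then have eq': "AE x in lebesgue. g x = g' x" by (intro AE_completion)
    have m': "h \<in> borel_measurable lebesgue" if "h \<in> borel_measurable lborel" for h :: "real^'n \<Rightarrow> real"
      using that by (rule measurable_completion)
    have "integrable lebesgue g'"
      using g integrable_cong_AE[OF borel_measurable_integrable[OF g] m'[OF g'] eq'] by blast
    then have "integrable lborel g'"
      by (simp add: integrable_completion)
    then have "AE x in lborel. g' x = 0"
    proof (rule AE_eq_0_if_box_integrals_eq_0)
      fix c d :: "real^'n"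
      have "(LINT x|lborel. indicator (box c d) x * g' x) = (LINT x|lebesgue. indicator (box c d) x * g' x)"
        by (rule integral_completion[symmetric]) measurable
      also have "\<dots> = (LINT x|lebesgue. indicator (box c d) x * g x)"
      proof (rule integral_cong_AE)
        have ind: "(indicator (box c d) :: real^'n \<Rightarrow> real) \<in> borel_measurable lebesgue"
          by (rule m') simp
        show "(\<lambda>x. indicator (box c d) x * g' x) \<in> borel_measurable lebesgue"
          by (rule borel_measurable_times[OF ind m'[OF g']])
        show "(\<lambda>x. indicator (box c d) x * g x) \<in> borel_measurable lebesgue"
          by (rule borel_measurable_times[OF ind borel_measurable_integrable[OF g]])
        show "AE x in lebesgue. indicator (box c d) x * g' x = indicator (box c d) x * g x"
          using eq' by eventually_elim simp
      qed
      finally show "(LINT x|lborel. indicator (box c d) x * g' x) = 0"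
        using ext by simp
    qed
    then have "AE x in lebesgue. g' x = 0" by (rule AE_completion)
    with eq' show ?thesis
      by eventually_elim (auto simp: g_def)
  qed
  define \<F> where "\<F> = {box a b |a b. cbox a b \<subseteq> \<Omega>}"
  obtain \<F>' where F': "\<F>' \<subseteq> \<F>" "countable \<F>'" "\<Union>\<F>' = \<Union>\<F>"
    by (rule Lindelof[of \<F>]) (auto simp: \<F>_def open_box)
  have cover: "\<Omega> \<subseteq> \<Union>\<F>"
  proof
    fix x assume "x \<in> \<Omega>"
    then obtain a b where "cbox a b \<subseteq> \<Omega>" "x \<in> box a b"
      using open_contains_cbox[OF \<Omega>] by metis
    then show "x \<in> \<Union>\<F>" by (auto simp: \<F>_def)
  qed
  have "AE x in lebesgue. \<forall>B\<in>\<F>'. x \<in> B \<longrightarrow> v x = 0"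
    using F' ae_box by (subst AE_ball_countable) (auto simp: \<F>_def)
  then have "AE x in lebesgue. x \<in> \<Omega> \<longrightarrow> v x = 0"
    by eventually_elim (use cover F'(3) in blast)
  then show ?thesis
    using meas by (subst AE_restrict_space_iff) auto
qed

section \<open>Weak derivatives and integration by parts\<close>

lemma has_weak_partial_unique:
  assumes \<Omega>: "open \<Omega>" and v: "has_weak_partial \<Omega> u i v" and w: "has_weak_partial \<Omega> u i w"
  shows "AE x in lebesgue_on \<Omega>. v x = w x"
proof -
  have vw: "v \<in> L2 (lebesgue_on \<Omega>)" "w \<in> L2 (lebesgue_on \<Omega>)"
    using v w by (auto simp: has_weak_partial_def)
  have "AE x in lebesgue_on \<Omega>. v x - w x = 0"
  proof (rule AE_eq_0_if_orthogonal_C1c[OF \<Omega> L2_diff[OF vw]])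
    fix \<phi> assume \<phi>: "\<phi> \<in> C1c \<Omega>"
    have "l2_inner \<Omega> v \<phi> = l2_inner \<Omega> w \<phi>"
      using v w \<phi> unfolding has_weak_partial_def by (metis minus_minus)
    then show "(LINT x|lebesgue_on \<Omega>. (v x - w x) * \<phi> x) = 0"
      using L2_inner_lincomb[OF vw C1c_L2[OF \<Omega> \<phi>], of "-1"] by (simp add: l2_inner_def)
  qed
  then show ?thesis by simp
qed

lemma H1_L2: "u \<in> H1 \<Omega> \<Longrightarrow> u \<in> L2 (lebesgue_on \<Omega>)"
  by (simp add: H1_def)

lemma wpd_has_weak_partial:
  assumes "u \<in> H1 \<Omega>"
  shows "has_weak_partial \<Omega> u i (wpd \<Omega> u i)"
proof -
  have "\<exists>v. has_weak_partial \<Omega> u i v" using assms by (simp add: H1_def)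
  then show ?thesis unfolding wpd_def by (rule someI_ex)
qed

lemma wpd_L2: "u \<in> H1 \<Omega> \<Longrightarrow> wpd \<Omega> u i \<in> L2 (lebesgue_on \<Omega>)"
  using wpd_has_weak_partial by (auto simp: has_weak_partial_def)

text \<open>
  The choice made in \<open>wpd\<close> is harmless: any weak partial derivative represents it.
\<close>

lemma wpd_AE_eqI:
  "open \<Omega> \<Longrightarrow> u \<in> H1 \<Omega> \<Longrightarrow> has_weak_partial \<Omega> u i v \<Longrightarrow> AE x in lebesgue_on \<Omega>. wpd \<Omega> u i x = v x"
  by (rule has_weak_partial_unique[OF _ wpd_has_weak_partial])

lemma has_weak_partial_lincomb:
  assumes \<Omega>: "open \<Omega>" and u: "u \<in> L2 (lebesgue_on \<Omega>)" "has_weak_partial \<Omega> u i v"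
    and w: "w \<in> L2 (lebesgue_on \<Omega>)" "has_weak_partial \<Omega> w i z"
  shows "has_weak_partial \<Omega> (\<lambda>x. u x + c * w x) i (\<lambda>x. v x + c * z x)"
  unfolding has_weak_partial_def
proof (intro conjI ballI)
  have vz: "v \<in> L2 (lebesgue_on \<Omega>)" "z \<in> L2 (lebesgue_on \<Omega>)"
    using u w by (auto simp: has_weak_partial_def)
  then show "(\<lambda>x. v x + c * z x) \<in> L2 (lebesgue_on \<Omega>)"
    by (rule L2_lincomb)
  fix \<phi> assume \<phi>: "\<phi> \<in> C1c \<Omega>"
  have "l2_inner \<Omega> u (pd \<phi> i) = - l2_inner \<Omega> v \<phi>" "l2_inner \<Omega> w (pd \<phi> i) = - l2_inner \<Omega> z \<phi>"
    using u(2) w(2) \<phi> by (auto simp: has_weak_partial_def)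
  then show "l2_inner \<Omega> (\<lambda>x. u x + c * w x) (pd \<phi> i) = - l2_inner \<Omega> (\<lambda>x. v x + c * z x) \<phi>"
    using L2_inner_lincomb[OF u(1) w(1) pd_C1c_L2[OF \<Omega> \<phi>]] L2_inner_lincomb[OF vz C1c_L2[OF \<Omega> \<phi>]]
    by (simp add: l2_inner_def)
qed

lemma H1_lincomb:
  assumes "open \<Omega>" "u \<in> H1 \<Omega>" "w \<in> H1 \<Omega>"
  shows "(\<lambda>x. u x + c * w x) \<in> H1 \<Omega>"
  unfolding H1_def
proof (intro CollectI conjI allI exI)
  show "(\<lambda>x. u x + c * w x) \<in> L2 (lebesgue_on \<Omega>)"
    by (intro L2_lincomb H1_L2 assms)
  show "has_weak_partial \<Omega> (\<lambda>x. u x + c * w x) i (\<lambda>x. wpd \<Omega> u i x + c * wpd \<Omega> w i x)" for i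
    by (intro has_weak_partial_lincomb wpd_has_weak_partial H1_L2 assms)
qed

lemma wpd_lincomb:
  assumes "open \<Omega>" "u \<in> H1 \<Omega>" "w \<in> H1 \<Omega>"
  shows "AE x in lebesgue_on \<Omega>. wpd \<Omega> (\<lambda>x. u x + c * w x) i x = wpd \<Omega> u i x + c * wpd \<Omega> w i x"
  by (intro wpd_AE_eqI H1_lincomb has_weak_partial_lincomb wpd_has_weak_partial H1_L2 assms)

text \<open>
  Being a weak partial derivative of \<open>u\<close> depends only on the class of \<open>u\<close> modulo null sets. So
  the choice operator in \<open>wpd\<close> is applied to the same predicate, and the representatives are
  equal everywhere, not only almost everywhere.
\<close>

lemma wpd_cong_AE:
  assumes "u \<in> L2 (lebesgue_on \<Omega>)" "w \<in> L2 (lebesgue_on \<Omega>)" and ae: "AE x in lebesgue_on \<Omega>. u x = w x"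
    and \<Omega>: "open \<Omega>"
  shows "wpd \<Omega> u = wpd \<Omega> w"
proof -
  have "l2_inner \<Omega> u (pd \<phi> i) = l2_inner \<Omega> w (pd \<phi> i)" if "\<phi> \<in> C1c \<Omega>" for \<phi> i
    unfolding l2_inner_def
  proof (rule integral_cong_AE)
    show "AE x in lebesgue_on \<Omega>. u x \<bullet> pd \<phi> i x = w x \<bullet> pd \<phi> i x"
      using ae by eventually_elim simp
  qed (use assms pd_C1c_L2[OF \<Omega> that] in \<open>auto dest!: L2_measurable\<close>)
  then have "has_weak_partial \<Omega> u i v = has_weak_partial \<Omega> w i v" for i v
    by (auto simp: has_weak_partial_def)
  then show ?thesis
    by (simp add: wpd_def fun_eq_iff)
qed

lemma C1c_H1: "open \<Omega> \<Longrightarrow> \<phi> \<in> C1c \<Omega> \<Longrightarrow> \<phi> \<in> H1 \<Omega>"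
  using C1c_L2 has_weak_partial_C1c unfolding H1_def by blast

lemma wpd_C1c: "open \<Omega> \<Longrightarrow> \<phi> \<in> C1c \<Omega> \<Longrightarrow> AE x in lebesgue_on \<Omega>. wpd \<Omega> \<phi> i x = pd \<phi> i x"
  by (intro wpd_AE_eqI C1c_H1 has_weak_partial_C1c)

lemma H10_H1: "u \<in> H10 \<Omega> \<Longrightarrow> u \<in> H1 \<Omega>"
  by (simp add: H10_def)

lemma H1_inner_wpd_C1c:
  assumes \<Omega>: "open \<Omega>" and V: "V \<in> H1 \<Omega>" and \<phi>: "\<phi> \<in> C1c \<Omega>"
  shows "l2_inner \<Omega> (wpd \<Omega> \<phi> i) V = - l2_inner \<Omega> \<phi> (wpd \<Omega> V i)"
proof -
  have "l2_inner \<Omega> (wpd \<Omega> \<phi> i) V = l2_inner \<Omega> V (pd \<phi> i)"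
    unfolding l2_inner_def
  proof (rule integral_cong_AE)
    show "AE x in lebesgue_on \<Omega>. wpd \<Omega> \<phi> i x \<bullet> V x = V x \<bullet> pd \<phi> i x"
      using wpd_C1c[OF \<Omega> \<phi>, of i] by eventually_elim simp
  qed (use H1_L2[OF V] wpd_L2[OF C1c_H1[OF \<Omega> \<phi>], of i] pd_C1c_L2[OF \<Omega> \<phi>, of i] in \<open>auto dest!: L2_measurable\<close>)
  also have "\<dots> = - l2_inner \<Omega> (wpd \<Omega> V i) \<phi>"
    using wpd_has_weak_partial[OF V, of i] \<phi> by (simp add: has_weak_partial_def)
  finally show ?thesis
    by (simp add: l2_inner_def mult.commute)
qed

text \<open>
  For test functions this is the definition of the weak derivative of \<open>V\<close>; both sides are
  continuous under $H^1$ convergence.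
\<close>

lemma integration_by_parts_H10:
  assumes \<Omega>: "open \<Omega>" and Q: "Q \<in> H10 \<Omega>" and V: "V \<in> H1 \<Omega>"
  shows "l2_inner \<Omega> (wpd \<Omega> Q i) V = - l2_inner \<Omega> Q (wpd \<Omega> V i)"
proof -
  obtain \<phi> where \<phi>: "\<And>n. \<phi> n \<in> C1c \<Omega>" and lim: "H1_tendsto \<Omega> \<phi> Q"
    using Q by (auto simp: H10_def)
  have "(\<lambda>n. l2_inner \<Omega> (wpd \<Omega> (\<phi> n) i) V) \<longlonglongrightarrow> l2_inner \<Omega> (wpd \<Omega> Q i) V"
    unfolding l2_inner_def inner_real_def
    by (intro L2_tendsto_inner wpd_L2 C1c_H1 \<Omega> \<phi> H10_H1 Q H1_L2 V)
      (use lim in \<open>simp add: H1_tendsto_def\<close>)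
  moreover have "(\<lambda>n. - l2_inner \<Omega> (\<phi> n) (wpd \<Omega> V i)) \<longlonglongrightarrow> - l2_inner \<Omega> Q (wpd \<Omega> V i)"
    unfolding l2_inner_def inner_real_def
    by (intro tendsto_minus L2_tendsto_inner wpd_L2 C1c_L2 \<Omega> \<phi> H10_H1 Q H1_L2 V)
      (use lim in \<open>simp add: H1_tendsto_def\<close>)
  ultimately show ?thesis
    using H1_inner_wpd_C1c[OF \<Omega> V \<phi>] by (simp add: LIMSEQ_unique)
qed

section \<open>A three-dimensional Loomis--Whitney inequality\<close>

text \<open>
  The Loomis--Whitney inequality, in the form used in Gagliardo's proof of the Sobolev
  inequality: the square of \<open>W\<close> is bounded by three factors, each independent of one
  coordinate. One application of the Cauchy--Schwarz inequality per coordinate integrates out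
  that coordinate. The coordinates carry arbitrary $\sigma$-finite measures, so that lower dimensional
  spaces can be treated as three-dimensional ones with trivial extra factors.
\<close>

lemma Loomis_Whitney_3:
  fixes W G1 G2 G3 :: "real \<Rightarrow> real \<Rightarrow> real \<Rightarrow> ennreal" and M1 M2 M3 :: "real measure"
  assumes sf: "sigma_finite_measure M1" "sigma_finite_measure M2" "sigma_finite_measure M3"
    and [measurable_cong]: "sets M1 = sets borel" "sets M2 = sets borel" "sets M3 = sets borel"
    and meas: "(\<lambda>(x, y, z). W x y z) \<in> borel_measurable (borel \<Otimes>\<^sub>M (borel \<Otimes>\<^sub>M borel))"
      "(\<lambda>(x, y, z). G1 x y z) \<in> borel_measurable (borel \<Otimes>\<^sub>M (borel \<Otimes>\<^sub>M borel))"
      "(\<lambda>(x, y, z). G2 x y z) \<in> borel_measurable (borel \<Otimes>\<^sub>M (borel \<Otimes>\<^sub>M borel))"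
      "(\<lambda>(x, y, z). G3 x y z) \<in> borel_measurable (borel \<Otimes>\<^sub>M (borel \<Otimes>\<^sub>M borel))"
    and le: "\<And>x y z. (W x y z)\<^sup>2 \<le>
      (\<integral>\<^sup>+t. G1 t y z \<partial>M1) * (\<integral>\<^sup>+t. G2 x t z \<partial>M2) * (\<integral>\<^sup>+t. G3 x y t \<partial>M3)"
  defines "I \<equiv> \<lambda>G. \<integral>\<^sup>+x. \<integral>\<^sup>+y. \<integral>\<^sup>+z. G x y z \<partial>M3 \<partial>M2 \<partial>M1"
  shows "(I W)\<^sup>2 \<le> I G1 * I G2 * I G3"
proof -
  interpret M1: sigma_finite_measure M1 by fact
  interpret M2: sigma_finite_measure M2 by fact
  interpret M3: sigma_finite_measure M3 by fact
  interpret P12: pair_sigma_finite M1 M2 ..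
  interpret P13: pair_sigma_finite M1 M3 ..
  interpret P23: pair_sigma_finite M2 M3 ..
  have comp: "(\<lambda>w. H (f w) (g w) (h w)) \<in> borel_measurable N"
    if "(\<lambda>(x, y, z). H x y z) \<in> borel_measurable (borel \<Otimes>\<^sub>M (borel \<Otimes>\<^sub>M borel))"
      "f \<in> borel_measurable N" "g \<in> borel_measurable N" "h \<in> borel_measurable N"
    for H :: "real \<Rightarrow> real \<Rightarrow> real \<Rightarrow> ennreal" and f g h N
    using measurable_compose[OF measurable_Pair[OF that(2) measurable_Pair[OF that(3,4)]] that(1)]
    by simp
  note [measurable (raw)] = meas[THEN comp]
  \<comment> \<open>each \<open>A\<close> is one of the three factors; its index names the coordinate integrated out\<close>
  define A1 where "A1 y z = (\<integral>\<^sup>+t. G1 t y z \<partial>M1)" for y z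
  define A2 where "A2 x z = (\<integral>\<^sup>+t. G2 x t z \<partial>M2)" for x z
  define A3 where "A3 x y = (\<integral>\<^sup>+t. G3 x y t \<partial>M3)" for x y
  have [measurable]: "(\<lambda>(y, z). A1 y z) \<in> borel_measurable (borel \<Otimes>\<^sub>M borel)"
    "(\<lambda>(x, z). A2 x z) \<in> borel_measurable (borel \<Otimes>\<^sub>M borel)"
    "(\<lambda>(x, y). A3 x y) \<in> borel_measurable (borel \<Otimes>\<^sub>M borel)"
    unfolding A1_def A2_def A3_def by measurable
  let ?B1 = "\<lambda>y. \<integral>\<^sup>+z. A1 y z \<partial>M3" and ?B2 = "\<lambda>x. \<integral>\<^sup>+z. A2 x z \<partial>M3" and ?B3 = "\<lambda>x. \<integral>\<^sup>+y. A3 x y \<partial>M2"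
  let ?K = "\<integral>\<^sup>+y. ?B1 y \<partial>M2"
  \<comment> \<open>integrate out \<open>z\<close>, keeping the factor without \<open>z\<close> outside; the next two steps do the same for \<open>y\<close> and \<open>x\<close>\<close>
  have 1: "(\<integral>\<^sup>+z. W x y z \<partial>M3)\<^sup>2 \<le> (A3 x y * ?B2 x) * ?B1 y" for x y
  proof -
    have "(\<integral>\<^sup>+z. W x y z \<partial>M3)\<^sup>2 \<le> (\<integral>\<^sup>+z. A3 x y * A2 x z \<partial>M3) * (\<integral>\<^sup>+z. A1 y z \<partial>M3)"
      by (rule nn_integral_Cauchy_Schwarz) (use le in \<open>simp_all add: A1_def A2_def A3_def mult_ac\<close>)
    then show ?thesis by (simp add: nn_integral_cmult)
  qed
  have 2: "(\<integral>\<^sup>+y. \<integral>\<^sup>+z. W x y z \<partial>M3 \<partial>M2)\<^sup>2 \<le> ?B3 x * (?B2 x * ?K)" for x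
  proof -
    have "(\<integral>\<^sup>+y. \<integral>\<^sup>+z. W x y z \<partial>M3 \<partial>M2)\<^sup>2 \<le> (\<integral>\<^sup>+y. A3 x y \<partial>M2) * (\<integral>\<^sup>+y. ?B2 x * ?B1 y \<partial>M2)"
      by (rule nn_integral_Cauchy_Schwarz) (use 1 in \<open>simp_all add: mult_ac\<close>)
    then show ?thesis by (simp add: nn_integral_cmult)
  qed
  have "(I W)\<^sup>2 \<le> (\<integral>\<^sup>+x. ?B3 x \<partial>M1) * (\<integral>\<^sup>+x. ?B2 x * ?K \<partial>M1)"
    unfolding I_def by (rule nn_integral_Cauchy_Schwarz) (use 2 in simp_all)
  also have "\<dots> = ?K * (\<integral>\<^sup>+x. ?B2 x \<partial>M1) * (\<integral>\<^sup>+x. ?B3 x \<partial>M1)"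
    by (simp add: nn_integral_multc mult_ac)
  also have "(\<integral>\<^sup>+x. ?B3 x \<partial>M1) = I G3"
    by (simp add: I_def A3_def)
  also have "(\<integral>\<^sup>+x. ?B2 x \<partial>M1) = I G2"
    unfolding I_def A2_def by (intro nn_integral_cong P23.Fubini') measurable
  also have "?K = I G1"
  proof -
    have "?K = (\<integral>\<^sup>+y. \<integral>\<^sup>+x. \<integral>\<^sup>+z. G1 x y z \<partial>M3 \<partial>M1 \<partial>M2)"
      unfolding A1_def by (intro nn_integral_cong P13.Fubini') measurable
    also have "\<dots> = I G1"
      unfolding I_def by (intro P12.Fubini') measurable
    finally show ?thesis .
  qed
  finally show ?thesis .
qed

text \<open>
  To treat the dimensions one, two and three at once, $\mathbb R^n$ is presented as an image of
  $\mathbb R^3$. An injection \<open>k\<close> of the coordinates into $\{0,1,2\}$ says which of the three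
  coordinates are in use; an unused coordinate carries a probability measure, so integration over
  it has no effect.
\<close>

definition axis_measure :: "('n \<Rightarrow> nat) \<Rightarrow> nat \<Rightarrow> real measure" where
  "axis_measure k j = (if j \<in> range k then lborel else density lborel (indicator {0..1}))"

definition assemble :: "('n \<Rightarrow> nat) \<Rightarrow> real \<times> real \<times> real \<Rightarrow> real^'n" where
  "assemble k p = (\<chi> i. if k i = 0 then fst p else if k i = 1 then fst (snd p) else snd (snd p))"

lemma sets_axis_measure [measurable_cong, simp]: "sets (axis_measure k j) = sets borel"
  by (simp add: axis_measure_def)

lemma space_axis_measure [simp]: "space (axis_measure k j) = UNIV"
  by (simp add: axis_measure_def)

lemma emeasure_axis_measure_UNIV: "j \<notin> range k \<Longrightarrow> emeasure (axis_measure k j) UNIV = 1"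
  by (simp add: axis_measure_def emeasure_density)

lemma sigma_finite_axis_measure: "sigma_finite_measure (axis_measure k j)"
proof (cases "j \<in> range k")
  case False
  then have "finite_measure (axis_measure k j)"
    by (intro finite_measureI) (simp add: emeasure_axis_measure_UNIV)
  then show ?thesis by (simp add: finite_measure_def)
qed (simp add: axis_measure_def sigma_finite_lborel)

lemma continuous_assemble: "continuous_on UNIV (assemble k)"
proof -
  have "continuous_on UNIV (\<lambda>p::real \<times> real \<times> real.
      if k i = 0 then fst p else if k i = 1 then fst (snd p) else snd (snd p))" for i
    by (cases "k i = 0"; cases "k i = 1") (auto intro!: continuous_intros)
  then show ?thesis
    unfolding assemble_def[abs_def] by (rule continuous_on_vec_lambda)
qed

lemma measurable_assemble [measurable]: "assemble k \<in> borel_measurable (borel \<Otimes>\<^sub>M (borel \<Otimes>\<^sub>M borel))"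
  using borel_measurable_continuous_onI[OF continuous_assemble[of k]] by (simp add: borel_prod)

lemma lborel_eq_distr_assemble:
  fixes k :: "'n::finite \<Rightarrow> nat"
  assumes k: "inj k" "range k \<subseteq> {0, 1, 2}"
  shows "(lborel :: (real^'n) measure) =
    distr (axis_measure k 0 \<Otimes>\<^sub>M (axis_measure k 1 \<Otimes>\<^sub>M axis_measure k 2)) borel (assemble k)"
    (is "_ = distr ?P _ _")
proof (rule lborel_eqI)
  interpret M1: sigma_finite_measure "axis_measure k 1" by (rule sigma_finite_axis_measure)
  interpret M2: sigma_finite_measure "axis_measure k 2" by (rule sigma_finite_axis_measure)
  interpret M12: pair_sigma_finite "axis_measure k 1" "axis_measure k 2" ..
  have T: "assemble k \<in> measurable ?P borel"
    by measurable
  fix l u :: "real^'n"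
  assume lu: "\<And>b. b \<in> Basis \<Longrightarrow> l \<bullet> b \<le> u \<bullet> b"
  have lu': "l $ i \<le> u $ i" for i
    using lu[of "axis i 1"] by (simp add: axis_in_Basis_iff inner_axis)
  \<comment> \<open>the preimage of a box is a product of intervals, with the whole line for an unused coordinate\<close>
  define J where "J j = (if j \<in> range k then {l $ inv k j <..< u $ inv k j} else (UNIV::real set))" for j
  define e where "e j = (if j \<in> range k then u $ inv k j - l $ inv k j else 1)" for j
  have [measurable]: "J j \<in> sets borel" for j by (simp add: J_def)
  have eJ: "emeasure (axis_measure k j) (J j) = ennreal (e j)" for j
  proof (cases "j \<in> range k")
    case True
    then show ?thesis using lu' by (simp add: J_def e_def axis_measure_def)
  qed (simp add: J_def e_def emeasure_axis_measure_UNIV)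
  have pre: "assemble k -` box l u \<inter> space ?P = J 0 \<times> (J 1 \<times> J 2)"
  proof -
    have "assemble k (x, y, z) \<in> box l u \<longleftrightarrow> x \<in> J 0 \<and> y \<in> J 1 \<and> z \<in> J 2" for x y z
    proof -
      define c where "c j = (if j = 0 then x else if j = 1 then y else z)" for j :: nat
      have a: "assemble k (x, y, z) $ i = c (k i)" for i
        by (simp add: assemble_def c_def)
      have "assemble k (x, y, z) \<in> box l u \<longleftrightarrow> (\<forall>i. c (k i) \<in> J (k i))"
        by (simp add: mem_box_cart a J_def k(1) inv_f_f)
      also have "\<dots> \<longleftrightarrow> (\<forall>j\<in>range k. c j \<in> J j)" by auto
      also have "\<dots> \<longleftrightarrow> (\<forall>j\<in>{0,1,2}. c j \<in> J j)"
      proof -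
        have "c j \<in> J j" if "j \<notin> range k" for j
          using that by (simp add: J_def)
        then show ?thesis using k(2) by blast
      qed
      finally show ?thesis by (simp add: c_def)
    qed
    then show ?thesis by (auto simp: space_pair_measure)
  qed
  have "emeasure (distr ?P borel (assemble k)) (box l u) = emeasure ?P (J 0 \<times> (J 1 \<times> J 2))"
    by (subst emeasure_distr[OF T]) (simp_all only: pre borel_open[OF open_box])
  also have "\<dots> = ennreal (e 0) * (ennreal (e 1) * ennreal (e 2))"
    by (simp del: One_nat_def add: M12.P.emeasure_pair_measure_Times M2.emeasure_pair_measure_Times eJ)
  also have "\<dots> = ennreal (\<Prod>j\<in>{0,1,2}. e j)"
    using lu' by (simp add: e_def ennreal_mult)
  also have "(\<Prod>j\<in>{0,1,2}. e j) = (\<Prod>j\<in>range k. e j)"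
    using k(2) by (intro prod.mono_neutral_right) (auto simp: e_def)
  also have "\<dots> = (\<Prod>i\<in>UNIV. u $ i - l $ i)"
    by (simp add: prod.reindex[OF k(1)] e_def k(1) inv_f_f)
  also have "\<dots> = (\<Prod>b\<in>Basis. (u - l) \<bullet> b)"
  proof -
    have B: "(Basis :: (real^'n) set) = range (\<lambda>i. axis i 1)"
      by (auto simp: Basis_vec_def)
    have "inj (\<lambda>i. axis i 1 :: real^'n)"
      by (auto simp: inj_on_def axis_eq_axis)
    then show ?thesis
      by (simp add: B prod.reindex inner_axis)
  qed
  finally show "emeasure (distr ?P borel (assemble k)) (box l u) = ennreal (\<Prod>b\<in>Basis. (u - l) \<bullet> b)" .
qed simp

section \<open>The Sobolev inequality\<close>

text \<open>
  Integrate the derivative along the line from a point outside the support.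
\<close>

lemma abs_le_nn_integral_pd_line:
  fixes f :: "real^'n \<Rightarrow> real"
  assumes f: "f \<in> C1" and K: "compact K" "\<And>x. x \<notin> K \<Longrightarrow> f x = 0"
  shows "ennreal \<bar>f (y + s *\<^sub>R axis i 1)\<bar> \<le> (\<integral>\<^sup>+t. ennreal \<bar>pd f i (y + t *\<^sub>R axis i 1)\<bar> \<partial>lborel)"
proof -
  let ?e = "axis i 1 :: real^'n"
  obtain R where R: "\<And>x. x \<in> K \<Longrightarrow> norm x \<le> R"
    using compact_imp_bounded[OF K(1)] by (auto simp: bounded_iff)
  \<comment> \<open>a parameter beyond which the line has left the support\<close>
  define a where "a = min s (- (\<bar>R\<bar> + norm y + 1))"
  have a: "a \<le> s" "\<bar>R\<bar> + norm y + 1 \<le> - a" by (simp_all add: a_def min_def)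
  have fa: "f (y + a *\<^sub>R ?e) = 0"
  proof (rule K(2), rule)
    assume "y + a *\<^sub>R ?e \<in> K"
    then have "norm (y + a *\<^sub>R ?e) \<le> R" by (rule R)
    moreover have "norm (a *\<^sub>R ?e) \<le> norm (y + a *\<^sub>R ?e) + norm y"
      using norm_triangle_ineq4[of "y + a *\<^sub>R ?e" y] by simp
    moreover have "norm (a *\<^sub>R ?e) = \<bar>a\<bar>"
      by (simp add: norm_axis_1)
    ultimately show False
      using a(2) by linarith
  qed
  let ?d = "\<lambda>t. pd f i (y + t *\<^sub>R ?e)"
  have cont: "continuous_on UNIV ?d"
    by (rule continuous_on_compose2[OF C1_pd_continuous[OF f]]) (auto intro!: continuous_intros)
  have "integral\<^sup>L lborel (\<lambda>t. indicator {a..s} t *\<^sub>R ?d t) = f (y + s *\<^sub>R ?e) - f (y + a *\<^sub>R ?e)"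
  proof (rule integral_FTC_atLeastAtMost[OF a(1)])
    show "((\<lambda>t. f (y + t *\<^sub>R ?e)) has_vector_derivative ?d t) (at t within {a..s})" for t
      using pd_line[OF f, of y i t]
      by (auto simp: has_real_derivative_iff_has_vector_derivative intro: has_vector_derivative_at_within)
    show "continuous_on {a..s} ?d"
      using cont by (rule continuous_on_subset) simp
  qed
  then have eq: "f (y + s *\<^sub>R ?e) = (LINT t|lborel. indicator {a..s} t *\<^sub>R ?d t)"
    using fa by simp
  have "integrable lborel (\<lambda>t. indicator {a..s} t *\<^sub>R ?d t)"
    by (intro borel_integrable_compact continuous_on_subset[OF cont]) auto
  from integral_norm_bound_ennreal[OF this]
  have "ennreal \<bar>f (y + s *\<^sub>R ?e)\<bar> \<le> (\<integral>\<^sup>+t. ennreal (norm (indicator {a..s} t *\<^sub>R ?d t)) \<partial>lborel)"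
    unfolding eq real_norm_def .
  also have "\<dots> \<le> (\<integral>\<^sup>+t. ennreal \<bar>?d t\<bar> \<partial>lborel)"
    by (intro nn_integral_mono ennreal_leI) (simp add: indicator_def)
  finally show ?thesis .
qed

lemma C1_power: "f \<in> C1 \<Longrightarrow> (\<lambda>x. f x ^ n) \<in> C1"
  by (rule C1_compose[where \<eta> = "\<lambda>t. t ^ n" and \<eta>' = "\<lambda>t. real n * t ^ (n - 1)"])
    (auto intro!: derivative_eq_intros continuous_intros)

lemma pd_power4:
  assumes "f \<in> C1"
  shows "pd (\<lambda>x. f x ^ 4) i x = 4 * f x ^ 3 * pd f i x"
proof -
  have "((\<lambda>x. f x ^ 4) has_derivative (\<lambda>h. 4 * f x ^ 3 * frechet_derivative f (at x) h)) (at x)"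
    using C1_has_derivative[OF assms] by (auto intro!: derivative_eq_intros)
  from pd_eqI[OF this] show ?thesis by (simp add: pd_def)
qed

text \<open>
  Write $S = \int f^6$ and let $E$ be the squared $H^1$ norm. Along the $i$th coordinate line $f^4$ is
  at most the integral of $G_i = |4 f^3 \partial_i f|$; for an unused coordinate the trivial bound
  by $G = f^4$ serves instead. The Loomis--Whitney inequality for $W = f^6$ gives
  $S^2 \le \prod_{j<3} \int G_j$. By the Cauchy--Schwarz inequality
  $(\int G_j)^2 \le 16 S E$ in both cases, so $S^4 \le (16 S E)^3$, and the finite number $S^3$ can be
  cancelled.
\<close>

lemma Sobolev_inequality_C1:
  fixes f :: "real^'n \<Rightarrow> real"
  assumes card: "CARD('n) \<le> 3" and f: "f \<in> C1" and K: "compact K" "\<And>x. x \<notin> K \<Longrightarrow> f x = 0"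
  shows "(\<integral>\<^sup>+x. ennreal (f x ^ 6) \<partial>lborel) \<le>
    4096 * ((\<integral>\<^sup>+x. ennreal ((f x)\<^sup>2) \<partial>lborel) + (\<Sum>i\<in>UNIV. \<integral>\<^sup>+x. ennreal ((pd f i x)\<^sup>2) \<partial>lborel)) ^ 3"
proof -
  define S where "S = (\<integral>\<^sup>+x. ennreal (f x ^ 6) \<partial>lborel)"
  define E where "E = (\<integral>\<^sup>+x. ennreal ((f x)\<^sup>2) \<partial>lborel) + (\<Sum>i\<in>UNIV. \<integral>\<^sup>+x. ennreal ((pd f i x)\<^sup>2) \<partial>lborel)"
  have cont: "continuous_on UNIV f" "continuous_on UNIV (pd f i)" for i
    using f by (auto intro: C1_continuous C1_pd_continuous)
  have fm[measurable]: "f \<in> borel_measurable borel" "pd f i \<in> borel_measurable borel" for i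
    by (intro borel_measurable_continuous_onI cont)+
  obtain k :: "'n \<Rightarrow> nat" where k: "inj k" "range k \<subseteq> {0, 1, 2}"
  proof -
    have "card (UNIV :: 'n set) \<le> card {0, 1, 2 :: nat}" using card by simp
    then show ?thesis
      using that card_le_inj[of "UNIV :: 'n set" "{0, 1, 2 :: nat}"] by auto
  qed
  let ?M = "axis_measure k"
  define G where "G j x = (if j \<in> range k then \<bar>4 * f x ^ 3 * pd f (inv k j) x\<bar> else f x ^ 4)" for j x
  have f6: "(\<lambda>x. f x ^ 6) \<in> borel_measurable borel" by measurable
  have Gm[measurable]: "G j \<in> borel_measurable borel" for j
    unfolding G_def[abs_def] by measurable
  define T where "T x y z = assemble k (x, y, z)" for x y z
  have Tm: "(\<lambda>(x, y, z). ennreal (h (T x y z))) \<in> borel_measurable (borel \<Otimes>\<^sub>M (borel \<Otimes>\<^sub>M borel))"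
    if "h \<in> borel_measurable borel" for h :: "real^'n \<Rightarrow> real"
    using measurable_compose[OF measurable_assemble[of k] that]
    unfolding T_def by (simp add: case_prod_unfold)
  have int_T: "(\<integral>\<^sup>+x. \<integral>\<^sup>+y. \<integral>\<^sup>+z. ennreal (h (T x y z)) \<partial>?M 2 \<partial>?M 1 \<partial>?M 0) = (\<integral>\<^sup>+x. ennreal (h x) \<partial>lborel)"
    if hm: "h \<in> borel_measurable borel" for h :: "real^'n \<Rightarrow> real"
  proof -
    interpret M1: sigma_finite_measure "?M 1" by (rule sigma_finite_axis_measure)
    interpret M2: sigma_finite_measure "?M 2" by (rule sigma_finite_axis_measure)
    interpret M12: pair_sigma_finite "?M 1" "?M 2" ..
    have m: "(\<lambda>p. ennreal (h (assemble k p))) \<in> borel_measurable (?M 0 \<Otimes>\<^sub>M (?M 1 \<Otimes>\<^sub>M ?M 2))"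
      using Tm[OF hm] by (simp add: T_def case_prod_unfold cong: measurable_cong_sets)
    have "(\<integral>\<^sup>+x. ennreal (h x) \<partial>lborel) = (\<integral>\<^sup>+p. ennreal (h (assemble k p)) \<partial>(?M 0 \<Otimes>\<^sub>M (?M 1 \<Otimes>\<^sub>M ?M 2)))"
    proof (subst lborel_eq_distr_assemble[OF k], rule nn_integral_distr)
      show "assemble k \<in> borel_measurable (?M 0 \<Otimes>\<^sub>M (?M 1 \<Otimes>\<^sub>M ?M 2))" by measurable
    qed (use hm in measurable)
    also have "\<dots> = (\<integral>\<^sup>+x. \<integral>\<^sup>+q. ennreal (h (assemble k (x, q))) \<partial>(?M 1 \<Otimes>\<^sub>M ?M 2) \<partial>?M 0)"
      by (rule M12.P.nn_integral_fst[OF m, symmetric])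
    also have "\<dots> = (\<integral>\<^sup>+x. \<integral>\<^sup>+y. \<integral>\<^sup>+z. ennreal (h (T x y z)) \<partial>?M 2 \<partial>?M 1 \<partial>?M 0)"
    proof (rule nn_integral_cong)
      fix x
      have "(\<lambda>q. ennreal (h (assemble k (x, q)))) \<in> borel_measurable (?M 1 \<Otimes>\<^sub>M ?M 2)"
        by (rule measurable_compose[OF measurable_Pair1' m]) simp
      from M2.nn_integral_fst[OF this]
      show "(\<integral>\<^sup>+q. ennreal (h (assemble k (x, q))) \<partial>(?M 1 \<Otimes>\<^sub>M ?M 2)) =
        (\<integral>\<^sup>+y. \<integral>\<^sup>+z. ennreal (h (T x y z)) \<partial>?M 2 \<partial>?M 1)"
        by (simp add: T_def)
    qed
    finally show ?thesis ..
  qed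
  have C4: "(\<lambda>x. f x ^ 4) \<in> C1" by (rule C1_power[OF f])
  have bound: "ennreal (f y ^ 4) \<le> (\<integral>\<^sup>+t. ennreal (G j (L t)) \<partial>?M j)"
    if L: "\<And>t i. L t $ i = (if k i = j then t else y $ i)" for y :: "real^'n" and L j
  proof (cases "j \<in> range k")
    case True
    define i where "i = inv k j"
    have i: "k i' = j \<longleftrightarrow> i' = i" for i'
      using True k(1) by (auto simp: i_def f_inv_into_f inj_eq)
    define z where "z = L 0"
    have Lz: "L t = z + t *\<^sub>R axis i 1" for t
      by (simp add: vec_eq_iff L z_def i axis_def)
    have yz: "y = z + (y $ i) *\<^sub>R axis i 1"
      by (simp add: vec_eq_iff L z_def i axis_def)
    have "ennreal (f y ^ 4) = ennreal \<bar>f (z + (y $ i) *\<^sub>R axis i 1) ^ 4\<bar>"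
      by (simp flip: yz)
    also have "\<dots> \<le> (\<integral>\<^sup>+t. ennreal \<bar>pd (\<lambda>x. f x ^ 4) i (z + t *\<^sub>R axis i 1)\<bar> \<partial>lborel)"
      by (rule abs_le_nn_integral_pd_line[OF C4 K(1)]) (simp add: K(2))
    also have "\<dots> = (\<integral>\<^sup>+t. ennreal (G j (L t)) \<partial>?M j)"
      using True by (simp add: pd_power4[OF f] G_def Lz i_def axis_measure_def)
    finally show ?thesis .
  next
    case False
    then have "L t = y" for t
      by (auto simp: vec_eq_iff L)
    then show ?thesis
      using False by (simp add: G_def emeasure_axis_measure_UNIV)
  qed
  define K' where "K' j = (\<integral>\<^sup>+x. ennreal (G j x) \<partial>lborel)" for j
  have "S\<^sup>2 \<le> K' 0 * K' 1 * K' 2"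
  proof -
    have "(ennreal (f (T x y z) ^ 6))\<^sup>2 \<le> (\<integral>\<^sup>+t. ennreal (G 0 (T t y z)) \<partial>?M 0) *
        (\<integral>\<^sup>+t. ennreal (G 1 (T x t z)) \<partial>?M 1) * (\<integral>\<^sup>+t. ennreal (G 2 (T x y t)) \<partial>?M 2)" for x y z
    proof -
      have cases: "k i = 0 \<or> k i = 1 \<or> k i = 2" for i using k(2) by blast
      let ?b = "ennreal (f (T x y z) ^ 4)"
      have "(ennreal (f (T x y z) ^ 6))\<^sup>2 = ?b * ?b * ?b"
        by (simp add: ennreal_power flip: ennreal_mult power_mult power_add)
      also have "\<dots> \<le> (\<integral>\<^sup>+t. ennreal (G 0 (T t y z)) \<partial>?M 0) *
        (\<integral>\<^sup>+t. ennreal (G 1 (T x t z)) \<partial>?M 1) * (\<integral>\<^sup>+t. ennreal (G 2 (T x y t)) \<partial>?M 2)"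
      proof (intro mult_mono bound)
        fix t i
        show "T t y z $ i = (if k i = 0 then t else T x y z $ i)"
          "T x t z $ i = (if k i = 1 then t else T x y z $ i)"
          "T x y t $ i = (if k i = 2 then t else T x y z $ i)"
          using cases[of i] by (auto simp: T_def assemble_def)
      qed auto
      finally show ?thesis .
    qed
    then have "(\<integral>\<^sup>+x. \<integral>\<^sup>+y. \<integral>\<^sup>+z. ennreal (f (T x y z) ^ 6) \<partial>?M 2 \<partial>?M 1 \<partial>?M 0)\<^sup>2 \<le>
      (\<integral>\<^sup>+x. \<integral>\<^sup>+y. \<integral>\<^sup>+z. ennreal (G 0 (T x y z)) \<partial>?M 2 \<partial>?M 1 \<partial>?M 0) *
      (\<integral>\<^sup>+x. \<integral>\<^sup>+y. \<integral>\<^sup>+z. ennreal (G 1 (T x y z)) \<partial>?M 2 \<partial>?M 1 \<partial>?M 0) *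
      (\<integral>\<^sup>+x. \<integral>\<^sup>+y. \<integral>\<^sup>+z. ennreal (G 2 (T x y z)) \<partial>?M 2 \<partial>?M 1 \<partial>?M 0)"
      by (intro Loomis_Whitney_3 sigma_finite_axis_measure sets_axis_measure Tm[OF f6] Tm[OF Gm])
    then show ?thesis
      by (simp only: int_T[OF f6] int_T[OF Gm] S_def K'_def)
  qed
  moreover have K'2: "(K' j)\<^sup>2 \<le> S * (16 * E)" for j
  proof -
    \<comment> \<open>chosen such that $G_j^2 = f^6 q$\<close>
    define q where "q x = (if j \<in> range k then 16 * (pd f (inv k j) x)\<^sup>2 else (f x)\<^sup>2)" for x
    have q0: "0 \<le> q x" for x by (simp add: q_def)
    have [measurable]: "q \<in> borel_measurable borel"
      unfolding q_def[abs_def] by measurable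
    have "(K' j)\<^sup>2 \<le> S * (\<integral>\<^sup>+x. ennreal (q x) \<partial>lborel)"
      unfolding K'_def S_def
    proof (rule nn_integral_Cauchy_Schwarz)
      fix x
      have "(G j x)\<^sup>2 = f x ^ 6 * q x"
        by (simp add: G_def q_def power_mult_distrib flip: power_mult power_add)
      moreover have "0 \<le> G j x" by (simp add: G_def)
      ultimately show "(ennreal (G j x))\<^sup>2 \<le> ennreal (f x ^ 6) * ennreal (q x)"
        using q0[of x] by (simp add: ennreal_power flip: ennreal_mult)
    qed measurable
    also have "(\<integral>\<^sup>+x. ennreal (q x) \<partial>lborel) \<le> 16 * E"
    proof (cases "j \<in> range k")
      case True
      have "(\<integral>\<^sup>+x. ennreal (q x) \<partial>lborel) = 16 * (\<integral>\<^sup>+x. ennreal ((pd f (inv k j) x)\<^sup>2) \<partial>lborel)"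
        using True by (simp add: q_def ennreal_mult nn_integral_cmult)
      also have "\<dots> \<le> 16 * (\<Sum>i\<in>UNIV. \<integral>\<^sup>+x. ennreal ((pd f i x)\<^sup>2) \<partial>lborel)"
        by (intro mult_left_mono member_le_sum) auto
      also have "\<dots> \<le> 16 * E"
        unfolding E_def by (intro mult_left_mono add_increasing) auto
      finally show ?thesis .
    next
      case False
      then have "(\<integral>\<^sup>+x. ennreal (q x) \<partial>lborel) \<le> 1 * E"
        by (simp add: q_def E_def)
      also have "\<dots> \<le> 16 * E"
        by (intro mult_right_mono) auto
      finally show ?thesis .
    qed
    finally show ?thesis by (simp add: mult_left_mono)
  qed
  ultimately have "(S\<^sup>2)\<^sup>2 \<le> (S * (16 * E)) * (S * (16 * E)) * (S * (16 * E))"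
  proof -
    assume "S\<^sup>2 \<le> K' 0 * K' 1 * K' 2"
    then have "(S\<^sup>2)\<^sup>2 \<le> (K' 0 * K' 1 * K' 2)\<^sup>2" by (intro power_mono) auto
    also have "\<dots> = (K' 0)\<^sup>2 * (K' 1)\<^sup>2 * (K' 2)\<^sup>2" by (simp only: power_mult_distrib)
    also have "\<dots> \<le> (S * (16 * E)) * (S * (16 * E)) * (S * (16 * E))"
      by (intro mult_mono K'2) auto
    finally show ?thesis .
  qed
  moreover have "S \<noteq> \<infinity>"
  proof -
    have "integrable lborel (\<lambda>x. f x ^ 6)"
      by (rule integrable_compact_support[OF _ K(1)]) (auto intro!: continuous_intros cont simp: K(2))
    then show ?thesis
      unfolding S_def by (subst nn_integral_eq_integral) auto
  qed
  ultimately have "S \<le> 4096 * E ^ 3"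
  proof (cases S; cases E)
    fix s e assume S: "S = ennreal s" "0 \<le> s" and E: "E = ennreal e" "0 \<le> e"
    assume "(S\<^sup>2)\<^sup>2 \<le> (S * (16 * E)) * (S * (16 * E)) * (S * (16 * E))"
    moreover define r where "r = s * (16 * e)"
    have r: "0 \<le> r" "S * (16 * E) = ennreal r"
      using S E by (simp_all add: r_def ennreal_mult)
    have "(S\<^sup>2)\<^sup>2 = ennreal ((s\<^sup>2)\<^sup>2)"
      using S by (simp add: ennreal_power)
    moreover have "ennreal r * ennreal r * ennreal r = ennreal (r * r * r)"
      using r(1) by (simp add: ennreal_mult)
    ultimately have "ennreal ((s\<^sup>2)\<^sup>2) \<le> ennreal (r * r * r)"
      unfolding r(2) by (simp only:)
    then have "(s\<^sup>2)\<^sup>2 \<le> r * r * r"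
      using r(1) by (subst (asm) ennreal_le_iff) auto
    then have "s ^ 3 * s \<le> s ^ 3 * (4096 * e ^ 3)"
      by (simp add: r_def power2_eq_square power3_eq_cube algebra_simps)
    then have "s \<le> 4096 * e ^ 3"
      using S(2) E(2) by (cases "s = 0") auto
    then have "ennreal s \<le> ennreal (4096 * e ^ 3)" by (rule ennreal_leI)
    then show ?thesis
      using S E by (simp add: ennreal_power ennreal_mult)
  qed (auto simp: ennreal_mult_top power3_eq_cube)
  then show ?thesis by (simp add: S_def E_def)
qed

section \<open>The embedding of $H^1_0$ into $L^6$\<close>

lemma nn_integral_lebesgue_on_borel:
  fixes f :: "real^'n \<Rightarrow> ennreal"
  assumes \<Omega>: "\<Omega> \<in> sets lebesgue" and 0: "\<And>x. x \<notin> \<Omega> \<Longrightarrow> f x = 0"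
  shows "(\<integral>\<^sup>+x. f x \<partial>lebesgue_on \<Omega>) = (\<integral>\<^sup>+x. f x \<partial>lborel)"
proof -
  have "(\<lambda>x. f x * indicator \<Omega> x) = f"
    using 0 by (auto simp: indicator_def fun_eq_iff)
  then show ?thesis
    using \<Omega> by (subst nn_integral_restrict_space) (auto simp: nn_integral_completion)
qed

lemma L2_tendsto_bounded:
  fixes f :: "nat \<Rightarrow> 'a \<Rightarrow> real"
  assumes f: "\<And>n. f n \<in> L2 M" and u: "u \<in> L2 M" and lim: "L2_tendsto M f u sequentially"
  obtains C where "\<And>n. (\<integral>\<^sup>+x. ennreal ((f n x)\<^sup>2) \<partial>M) \<le> ennreal C"
proof -
  let ?d = "\<lambda>n. LINT x|M. (f n x - u x)\<^sup>2"
  have "?d \<longlonglongrightarrow> 0"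
    using lim L2_tendsto_iff_integral[of f M u sequentially, OF f u] by blast
  then have "Bseq ?d"
    by (intro convergent_imp_Bseq) (auto simp: convergent_def)
  then obtain B where B: "\<And>n. \<bar>?d n\<bar> \<le> B"
    by (auto simp: Bseq_def)
  have "(\<integral>\<^sup>+x. ennreal ((f n x)\<^sup>2) \<partial>M) \<le> ennreal (2 * B + 2 * (LINT x|M. (u x)\<^sup>2))" for n
  proof -
    have i: "integrable M (\<lambda>x. (f n x - u x)\<^sup>2)" "integrable M (\<lambda>x. (u x)\<^sup>2)"
      by (intro L2_integrable_square L2_diff f u)+
    have "(LINT x|M. (f n x)\<^sup>2) \<le> (LINT x|M. 2 * (f n x - u x)\<^sup>2 + 2 * (u x)\<^sup>2)"
    proof (rule integral_mono)
      show "integrable M (\<lambda>x. 2 * (f n x - u x)\<^sup>2 + 2 * (u x)\<^sup>2)"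
        using i by (intro Bochner_Integration.integrable_add integrable_mult_right)
      show "(f n x)\<^sup>2 \<le> 2 * (f n x - u x)\<^sup>2 + 2 * (u x)\<^sup>2" for x
        using zero_le_power2[of "f n x - u x - u x"] by (simp add: power2_eq_square algebra_simps)
    qed (rule L2_integrable_square[OF f])
    also have "\<dots> = 2 * ?d n + 2 * (LINT x|M. (u x)\<^sup>2)"
      using i by simp
    also have "\<dots> \<le> 2 * B + 2 * (LINT x|M. (u x)\<^sup>2)"
      using B[of n] by linarith
    finally show ?thesis
      unfolding nn_integral_square_L2[OF f] by (rule ennreal_leI)
  qed
  then show ?thesis by (rule that)
qed

text \<open>
  The Sobolev inequality bounds $\int \varphi_n^6$ along an approximating sequence of test functions.
  A subsequence converges almost everywhere, and Fatou's lemma transfers the bound to the limit.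
\<close>

lemma H10_integrable_power6:
  fixes u :: "real^'n \<Rightarrow> real"
  assumes card: "CARD('n) \<le> 3" and \<Omega>: "open \<Omega>" and u: "u \<in> H10 \<Omega>"
  shows "integrable (lebesgue_on \<Omega>) (\<lambda>x. u x ^ 6)"
proof -
  let ?M = "lebesgue_on \<Omega>"
  obtain \<phi> where \<phi>: "\<And>n. \<phi> n \<in> C1c \<Omega>" and lim: "H1_tendsto \<Omega> \<phi> u"
    using u by (auto simp: H10_def)
  have meas: "\<Omega> \<in> sets lebesgue" by (rule open_lebesgue_sets[OF \<Omega>])
  have \<phi>1: "\<phi> n \<in> H1 \<Omega>" for n by (rule C1c_H1[OF \<Omega> \<phi>])
  have u1: "u \<in> H1 \<Omega>" by (rule H10_H1[OF u])
  have [measurable]: "u \<in> borel_measurable ?M" "\<phi> n \<in> borel_measurable ?M" for n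
    by (intro L2_measurable H1_L2 u1 \<phi>1)+
  obtain C where C: "\<And>n. (\<integral>\<^sup>+x. ennreal ((\<phi> n x)\<^sup>2) \<partial>?M) \<le> ennreal C"
    by (rule L2_tendsto_bounded[of \<phi> ?M u]) (use lim \<phi>1 u1 in \<open>auto simp: H1_tendsto_def H1_L2\<close>)
  have "\<exists>C. \<forall>n. (\<integral>\<^sup>+x. ennreal ((wpd \<Omega> (\<phi> n) i x)\<^sup>2) \<partial>?M) \<le> ennreal C" for i
    by (rule L2_tendsto_bounded[of "\<lambda>n. wpd \<Omega> (\<phi> n) i" ?M "wpd \<Omega> u i"])
      (use lim \<phi>1 u1 in \<open>auto simp: H1_tendsto_def wpd_L2\<close>)
  then obtain D where D: "\<And>i n. (\<integral>\<^sup>+x. ennreal ((wpd \<Omega> (\<phi> n) i x)\<^sup>2) \<partial>?M) \<le> ennreal (D i)"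
    by metis
  define B where "B = 4096 * (ennreal C + (\<Sum>i\<in>UNIV. ennreal (D i))) ^ 3"
  have bound: "(\<integral>\<^sup>+x. ennreal (\<phi> n x ^ 6) \<partial>?M) \<le> B" for n
  proof -
    have C1: "\<phi> n \<in> C1" using \<phi>[of n] by (simp add: C1c_def)
    obtain K where K: "compact K" "\<And>x. x \<notin> K \<Longrightarrow> \<phi> n x = 0"
      using \<phi>[of n] by (auto simp: C1c_def)
    have f2: "(\<integral>\<^sup>+x. ennreal ((\<phi> n x)\<^sup>2) \<partial>lborel) = (\<integral>\<^sup>+x. ennreal ((\<phi> n x)\<^sup>2) \<partial>?M)"
      using C1c_eq_0[OF \<phi>[of n]] by (intro nn_integral_lebesgue_on_borel[symmetric] meas) simp
    have d2: "(\<integral>\<^sup>+x. ennreal ((pd (\<phi> n) i x)\<^sup>2) \<partial>lborel) = (\<integral>\<^sup>+x. ennreal ((wpd \<Omega> (\<phi> n) i x)\<^sup>2) \<partial>?M)" for i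
    proof -
      have "(\<integral>\<^sup>+x. ennreal ((pd (\<phi> n) i x)\<^sup>2) \<partial>lborel) = (\<integral>\<^sup>+x. ennreal ((pd (\<phi> n) i x)\<^sup>2) \<partial>?M)"
        using pd_C1c_eq_0[OF \<phi>[of n]] by (intro nn_integral_lebesgue_on_borel[symmetric] meas) simp
      also have "\<dots> = (\<integral>\<^sup>+x. ennreal ((wpd \<Omega> (\<phi> n) i x)\<^sup>2) \<partial>?M)"
      proof (rule nn_integral_cong_AE)
        show "AE x in ?M. ennreal ((pd (\<phi> n) i x)\<^sup>2) = ennreal ((wpd \<Omega> (\<phi> n) i x)\<^sup>2)"
          using wpd_C1c[OF \<Omega> \<phi>[of n], of i] by eventually_elim simp
      qed
      finally show ?thesis .
    qed
    have "(\<integral>\<^sup>+x. ennreal (\<phi> n x ^ 6) \<partial>?M) = (\<integral>\<^sup>+x. ennreal (\<phi> n x ^ 6) \<partial>lborel)"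
      using C1c_eq_0[OF \<phi>[of n]] by (intro nn_integral_lebesgue_on_borel meas) simp
    also have "\<dots> \<le> 4096 * ((\<integral>\<^sup>+x. ennreal ((\<phi> n x)\<^sup>2) \<partial>lborel) +
        (\<Sum>i\<in>UNIV. \<integral>\<^sup>+x. ennreal ((pd (\<phi> n) i x)\<^sup>2) \<partial>lborel)) ^ 3"
      by (rule Sobolev_inequality_C1[OF card C1 K])
    also have "\<dots> = 4096 * ((\<integral>\<^sup>+x. ennreal ((\<phi> n x)\<^sup>2) \<partial>?M) +
        (\<Sum>i\<in>UNIV. \<integral>\<^sup>+x. ennreal ((wpd \<Omega> (\<phi> n) i x)\<^sup>2) \<partial>?M)) ^ 3"
      by (simp only: f2 d2)
    also have "\<dots> \<le> B"
      unfolding B_def by (intro mult_left_mono power_mono add_mono sum_mono C D) auto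
    finally show ?thesis .
  qed
  have "\<exists>r. strict_mono r \<and> (AE x in ?M. (\<lambda>n. (\<phi> (r n) x - u x)\<^sup>2) \<longlonglongrightarrow> 0)"
  proof (rule tendsto_L1_AE_subseq)
    show "integrable ?M (\<lambda>x. (\<phi> n x - u x)\<^sup>2)" for n
      by (intro L2_integrable_square L2_diff H1_L2 \<phi>1 u1)
    show "(\<lambda>n. LINT x|?M. norm ((\<phi> n x - u x)\<^sup>2)) \<longlonglongrightarrow> 0"
      using lim L2_tendsto_iff_integral[of \<phi> ?M u sequentially, OF H1_L2[OF \<phi>1] H1_L2[OF u1]]
      by (simp add: H1_tendsto_def)
  qed
  then obtain r where ae: "AE x in ?M. (\<lambda>n. (\<phi> (r n) x - u x)\<^sup>2) \<longlonglongrightarrow> 0"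
    by blast
  have "(\<integral>\<^sup>+x. ennreal (u x ^ 6) \<partial>?M) = (\<integral>\<^sup>+x. liminf (\<lambda>n. ennreal (\<phi> (r n) x ^ 6)) \<partial>?M)"
  proof (rule nn_integral_cong_AE)
    show "AE x in ?M. ennreal (u x ^ 6) = liminf (\<lambda>n. ennreal (\<phi> (r n) x ^ 6))"
      using ae
    proof eventually_elim
      case (elim x)
      then have "(\<lambda>n. \<bar>\<phi> (r n) x - u x\<bar>) \<longlonglongrightarrow> 0"
        using tendsto_real_sqrt[of "\<lambda>n. (\<phi> (r n) x - u x)\<^sup>2" 0] by simp
      then have "(\<lambda>n. \<phi> (r n) x) \<longlonglongrightarrow> u x"
        by (rule LIM_zero_cancel[OF tendsto_rabs_zero_cancel])
      then have "(\<lambda>n. ennreal (\<phi> (r n) x ^ 6)) \<longlonglongrightarrow> ennreal (u x ^ 6)"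
        by (intro tendsto_ennrealI tendsto_power)
      then show ?case
        by (intro lim_imp_Liminf[symmetric]) auto
    qed
  qed
  also have "\<dots> \<le> liminf (\<lambda>n. \<integral>\<^sup>+x. ennreal (\<phi> (r n) x ^ 6) \<partial>?M)"
    by (rule nn_integral_liminf) measurable
  also have "\<dots> \<le> B"
    by (intro Liminf_le) (auto simp: bound)
  also have "B < \<infinity>"
    unfolding B_def by (simp add: ennreal_mult_less_top power_less_top_ennreal)
  finally show ?thesis
    by (intro integrableI_bounded) auto
qed

text \<open>
  With $c = \max(|u|,|w|)$ the monomial is at most $c^{k+l} \le c^2 + c^6$.
\<close>

lemma integrable_monomial:
  fixes u w :: "'a \<Rightarrow> real"
  assumes u: "u \<in> L2 M" "integrable M (\<lambda>x. u x ^ 6)" and w: "w \<in> L2 M" "integrable M (\<lambda>x. w x ^ 6)"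
    and m: "2 \<le> k + l" "k + l \<le> 6"
  shows "integrable M (\<lambda>x. u x ^ k * w x ^ l)"
proof (rule Bochner_Integration.integrable_bound)
  show "integrable M (\<lambda>x. ((u x)\<^sup>2 + u x ^ 6) + ((w x)\<^sup>2 + w x ^ 6))"
    by (intro Bochner_Integration.integrable_add u w L2_integrable_square)
  show "(\<lambda>x. u x ^ k * w x ^ l) \<in> borel_measurable M"
    using L2_measurable[OF u(1)] L2_measurable[OF w(1)] by measurable
  have "\<bar>a ^ k * b ^ l\<bar> \<le> (a\<^sup>2 + a ^ 6) + (b\<^sup>2 + b ^ 6)" for a b :: real
  proof -
    define c where "c = max \<bar>a\<bar> \<bar>b\<bar>"
    have c: "\<bar>a\<bar> \<le> c" "\<bar>b\<bar> \<le> c" "0 \<le> c" by (auto simp: c_def)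
    have "\<bar>a ^ k * b ^ l\<bar> \<le> c ^ k * c ^ l"
      unfolding abs_mult power_abs by (intro mult_mono power_mono c zero_le_power) auto
    also have "\<dots> = c ^ (k + l)" by (simp add: power_add)
    also have "\<dots> \<le> c\<^sup>2 + c ^ 6"
    proof (cases "c \<le> 1")
      case True
      then have "c ^ (k + l) \<le> c\<^sup>2" using c(3) m by (intro power_decreasing) auto
      then show ?thesis using c(3) by (simp add: add_increasing2)
    next
      case False
      then have "c ^ (k + l) \<le> c ^ 6" using m by (intro power_increasing) auto
      then show ?thesis by (simp add: add_increasing)
    qed
    also have "\<dots> \<le> (a\<^sup>2 + a ^ 6) + (b\<^sup>2 + b ^ 6)"
    proof (cases "\<bar>a\<bar> \<le> \<bar>b\<bar>")
      case True
      then have "c\<^sup>2 = b\<^sup>2" "c ^ 6 = b ^ 6" by (simp_all add: c_def max_def power_even_abs)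
      then show ?thesis by (simp add: add_nonneg_nonneg)
    next
      case False
      then have "c\<^sup>2 = a\<^sup>2" "c ^ 6 = a ^ 6" by (simp_all add: c_def max_def power_even_abs)
      then show ?thesis by (simp add: add_nonneg_nonneg)
    qed
    finally show ?thesis .
  qed
  then show "AE x in M. norm (u x ^ k * w x ^ l) \<le> norm ((u x)\<^sup>2 + u x ^ 6 + ((w x)\<^sup>2 + w x ^ 6))"
    by (simp add: add_nonneg_nonneg)
qed

section \<open>Linearity of the potential problem\<close>

lemma L2_tendsto_cong_AE:
  assumes f: "\<And>n. AE x in M. f n x = f' n x" and u: "AE x in M. u x = u' x"
  shows "L2_tendsto M f u G \<longleftrightarrow> L2_tendsto M f' u' G"
proof -
  have "(\<integral>\<^sup>+x. ennreal ((f n x - u x)\<^sup>2) \<partial>M) = (\<integral>\<^sup>+x. ennreal ((f' n x - u' x)\<^sup>2) \<partial>M)" for n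
  proof (rule nn_integral_cong_AE)
    show "AE x in M. ennreal ((f n x - u x)\<^sup>2) = ennreal ((f' n x - u' x)\<^sup>2)"
      using f[of n] u by eventually_elim simp
  qed
  then show ?thesis by (simp add: L2_tendsto_def)
qed

lemma H1_tendsto_lincomb:
  assumes \<Omega>: "open \<Omega>" and u: "u \<in> H1 \<Omega>" "H1_tendsto \<Omega> f u" and w: "w \<in> H1 \<Omega>" "H1_tendsto \<Omega> h w"
  shows "H1_tendsto \<Omega> (\<lambda>n x. f n x + c * h n x) (\<lambda>x. u x + c * w x)"
  unfolding H1_tendsto_def
proof (intro conjI allI)
  have f: "f n \<in> H1 \<Omega>" and h: "h n \<in> H1 \<Omega>" for n
    using u(2) w(2) by (auto simp: H1_tendsto_def)
  show "(\<lambda>x. f n x + c * h n x) \<in> H1 \<Omega>" for n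
    by (rule H1_lincomb[OF \<Omega> f h])
  show "L2_tendsto (lebesgue_on \<Omega>) (\<lambda>n x. f n x + c * h n x) (\<lambda>x. u x + c * w x) sequentially"
    by (intro L2_tendsto_lincomb L2_measurable H1_L2 f h u(1) w(1))
      (use u(2) w(2) in \<open>auto simp: H1_tendsto_def\<close>)
  show "L2_tendsto (lebesgue_on \<Omega>) (\<lambda>n. wpd \<Omega> (\<lambda>x. f n x + c * h n x) i)
      (wpd \<Omega> (\<lambda>x. u x + c * w x) i) sequentially" for i
    unfolding L2_tendsto_cong_AE[OF wpd_lincomb[OF \<Omega> f h] wpd_lincomb[OF \<Omega> u(1) w(1)]]
    by (intro L2_tendsto_lincomb L2_measurable wpd_L2 f h u(1) w(1))
      (use u(2) w(2) in \<open>auto simp: H1_tendsto_def\<close>)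
qed

lemma C1c_lincomb:
  assumes "\<phi> \<in> C1c \<Omega>" "\<psi> \<in> C1c \<Omega>"
  shows "(\<lambda>x. \<phi> x + c * \<psi> x) \<in> C1c \<Omega>"
proof -
  obtain K L where K: "compact K" "K \<subseteq> \<Omega>" "\<And>x. x \<notin> K \<Longrightarrow> \<phi> x = 0"
    and L: "compact L" "L \<subseteq> \<Omega>" "\<And>x. x \<notin> L \<Longrightarrow> \<psi> x = 0"
    using assms by (auto simp: C1c_def)
  have "(\<lambda>x. \<phi> x + c * \<psi> x) \<in> C1"
    using assms by (intro C1_lincomb) (auto simp: C1c_def)
  moreover have "compact (K \<union> L)" "K \<union> L \<subseteq> \<Omega>" "\<forall>x. x \<notin> K \<union> L \<longrightarrow> \<phi> x + c * \<psi> x = 0"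
    using K L by (auto intro: compact_Un)
  ultimately show ?thesis
    unfolding C1c_def by blast
qed

lemma H10_lincomb:
  assumes \<Omega>: "open \<Omega>" and u: "u \<in> H10 \<Omega>" and w: "w \<in> H10 \<Omega>"
  shows "(\<lambda>x. u x + c * w x) \<in> H10 \<Omega>"
proof -
  obtain \<phi> \<psi> where \<phi>: "\<And>n. \<phi> n \<in> C1c \<Omega>" "H1_tendsto \<Omega> \<phi> u"
    and \<psi>: "\<And>n. \<psi> n \<in> C1c \<Omega>" "H1_tendsto \<Omega> \<psi> w"
    using u w by (auto simp: H10_def)
  have "H1_tendsto \<Omega> (\<lambda>n x. \<phi> n x + c * \<psi> n x) (\<lambda>x. u x + c * w x)"
    by (intro H1_tendsto_lincomb \<Omega> H10_H1 u w \<phi> \<psi>)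
  moreover have "(\<lambda>x. \<phi> n x + c * \<psi> n x) \<in> C1c \<Omega>" for n
    by (intro C1c_lincomb \<phi> \<psi>)
  ultimately show ?thesis
    unfolding H10_def using H1_lincomb[OF \<Omega> H10_H1[OF u] H10_H1[OF w]]
    by (intro CollectI conjI exI[of _ "\<lambda>n x. \<phi> n x + c * \<psi> n x"]) auto
qed

text \<open>
  Needed for the measurability of restrictions to the boundary in \<open>has_trace_lincomb\<close>.
\<close>

lemma sets_surface_measure: "sets surface_measure = sets borel"
  unfolding surface_measure_def by (metis sets.sets_measure_of_eq space_borel)

lemma VD_H1: "w \<in> VD \<Omega> \<Gamma> \<Longrightarrow> w \<in> H1 \<Omega>"
  by (simp add: VD_def)

lemma has_trace_lincomb:
  assumes \<Omega>: "open \<Omega>" and u: "u \<in> H1 \<Omega>" "has_trace \<Omega> u a" and w: "w \<in> H1 \<Omega>" "has_trace \<Omega> w b"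
  shows "has_trace \<Omega> (\<lambda>x. u x + c * w x) (\<lambda>x. a x + c * b x)"
proof -
  let ?S = "restrict_space surface_measure (frontier \<Omega>)"
  have a: "a \<in> L2 ?S" and b: "b \<in> L2 ?S"
    using u w by (auto simp: has_trace_def)
  obtain f h where f: "\<And>n. f n \<in> C1" "H1_tendsto \<Omega> f u" "L2_tendsto ?S f a sequentially"
    and h: "\<And>n. h n \<in> C1" "H1_tendsto \<Omega> h w" "L2_tendsto ?S h b sequentially"
    using u(2) w(2) by (auto simp: has_trace_def)
  have C1_meas: "\<phi> \<in> borel_measurable ?S" if "\<phi> \<in> C1" for \<phi>
    using borel_measurable_continuous_onI[OF C1_continuous[OF that]]
    by (intro measurable_restrict_space1) (simp cong: measurable_cong_sets add: sets_surface_measure)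
  show ?thesis
    unfolding has_trace_def
  proof (intro conjI exI allI)
    show "(\<lambda>x. a x + c * b x) \<in> L2 ?S" by (rule L2_lincomb[OF a b])
    show "(\<lambda>x. f n x + c * h n x) \<in> C1" for n by (rule C1_lincomb[OF f(1) h(1)])
    show "H1_tendsto \<Omega> (\<lambda>n x. f n x + c * h n x) (\<lambda>x. u x + c * w x)"
      by (rule H1_tendsto_lincomb[OF \<Omega> u(1) f(2) w(1) h(2)])
    show "L2_tendsto ?S (\<lambda>n x. f n x + c * h n x) (\<lambda>x. a x + c * b x) sequentially"
      by (intro L2_tendsto_lincomb C1_meas f h L2_measurable[OF a] L2_measurable[OF b])
  qed
qed

lemma VD_lincomb:
  assumes \<Omega>: "open \<Omega>" and u: "u \<in> VD \<Omega> \<Gamma>" and w: "w \<in> VD \<Omega> \<Gamma>"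
  shows "(\<lambda>x. u x + c * w x) \<in> VD \<Omega> \<Gamma>"
proof -
  let ?S = "restrict_space surface_measure (frontier \<Omega>)"
  obtain a b where a: "has_trace \<Omega> u a" "AE x in ?S. x \<in> \<Gamma> \<longrightarrow> a x = 0"
    and b: "has_trace \<Omega> w b" "AE x in ?S. x \<in> \<Gamma> \<longrightarrow> b x = 0"
    using u w by (auto simp: VD_def)
  have "AE x in ?S. x \<in> \<Gamma> \<longrightarrow> a x + c * b x = 0"
    using a(2) b(2) by eventually_elim auto
  then show ?thesis
    unfolding VD_def
    using has_trace_lincomb[OF \<Omega> VD_H1[OF u] a(1) VD_H1[OF w] b(1)] H1_lincomb[OF \<Omega> VD_H1[OF u] VD_H1[OF w]]
    by blast
qed

lemma wgrad_inner: "wgrad \<Omega> u x \<bullet> wgrad \<Omega> w x = (\<Sum>i\<in>UNIV. wpd \<Omega> u i x * wpd \<Omega> w i x)"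
  by (simp add: inner_vec_def wgrad_def)

lemma integrable_wgrad_inner:
  assumes "u \<in> H1 \<Omega>" "w \<in> H1 \<Omega>"
  shows "integrable (lebesgue_on \<Omega>) (\<lambda>x. wgrad \<Omega> u x \<bullet> wgrad \<Omega> w x)"
  unfolding wgrad_inner by (intro Bochner_Integration.integrable_sum L2_integrable_mult wpd_L2 assms)

lemma wgrad_lincomb:
  assumes "open \<Omega>" "u \<in> H1 \<Omega>" "w \<in> H1 \<Omega>"
  shows "AE x in lebesgue_on \<Omega>. wgrad \<Omega> (\<lambda>x. u x + c * w x) x = wgrad \<Omega> u x + c *\<^sub>R wgrad \<Omega> w x"
proof -
  have "AE x in lebesgue_on \<Omega>. \<forall>i. wpd \<Omega> (\<lambda>x. u x + c * w x) i x = wpd \<Omega> u i x + c * wpd \<Omega> w i x"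
    unfolding AE_all_countable using wpd_lincomb[OF assms] by blast
  then show ?thesis
    by eventually_elim (simp add: vec_eq_iff wgrad_def)
qed

lemma l2_inner_commute: "l2_inner \<Omega> f h = l2_inner \<Omega> h f"
  by (simp add: l2_inner_def inner_commute)

lemma l2_inner_scaleR: "l2_inner \<Omega> (\<lambda>x. c *\<^sub>R f x) h = c * l2_inner \<Omega> f h"
  by (simp add: l2_inner_def)

lemma l2_inner_lincomb:
  fixes f h q :: "real^'n \<Rightarrow> real"
  assumes "f \<in> L2 (lebesgue_on \<Omega>)" "h \<in> L2 (lebesgue_on \<Omega>)" "q \<in> L2 (lebesgue_on \<Omega>)"
  shows "l2_inner \<Omega> (\<lambda>x. f x + c * h x) q = l2_inner \<Omega> f q + c * l2_inner \<Omega> h q"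
  using L2_inner_lincomb[OF assms] by (simp add: l2_inner_def)

lemma l2_inner_wgrad_lincomb:
  assumes \<Omega>: "open \<Omega>" and u: "u \<in> H1 \<Omega>" and w: "w \<in> H1 \<Omega>" and z: "z \<in> H1 \<Omega>"
  shows "l2_inner \<Omega> (wgrad \<Omega> (\<lambda>x. u x + c * w x)) (wgrad \<Omega> z) =
    l2_inner \<Omega> (wgrad \<Omega> u) (wgrad \<Omega> z) + c * l2_inner \<Omega> (wgrad \<Omega> w) (wgrad \<Omega> z)"
proof -
  let ?M = "lebesgue_on \<Omega>"
  have "l2_inner \<Omega> (wgrad \<Omega> (\<lambda>x. u x + c * w x)) (wgrad \<Omega> z) =
      (LINT x|?M. wgrad \<Omega> u x \<bullet> wgrad \<Omega> z x + c * (wgrad \<Omega> w x \<bullet> wgrad \<Omega> z x))"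
    unfolding l2_inner_def
  proof (rule integral_cong_AE)
    show "AE x in ?M. wgrad \<Omega> (\<lambda>x. u x + c * w x) x \<bullet> wgrad \<Omega> z x =
        wgrad \<Omega> u x \<bullet> wgrad \<Omega> z x + c * (wgrad \<Omega> w x \<bullet> wgrad \<Omega> z x)"
      using wgrad_lincomb[OF \<Omega> u w, of c] by eventually_elim (simp add: inner_add_left)
  qed (intro borel_measurable_integrable Bochner_Integration.integrable_add integrable_mult_right
      integrable_wgrad_inner H1_lincomb assms)+
  also have "\<dots> = l2_inner \<Omega> (wgrad \<Omega> u) (wgrad \<Omega> z) + c * l2_inner \<Omega> (wgrad \<Omega> w) (wgrad \<Omega> z)"
    unfolding l2_inner_def by (simp add: integrable_wgrad_inner u w z)
  finally show ?thesis .
qed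

lemma Dirichlet_integral_lincomb:
  assumes \<Omega>: "open \<Omega>" and u: "u \<in> H1 \<Omega>" and w: "w \<in> H1 \<Omega>"
  shows "l2_inner \<Omega> (wgrad \<Omega> (\<lambda>x. u x + c * w x)) (wgrad \<Omega> (\<lambda>x. u x + c * w x)) =
    l2_inner \<Omega> (wgrad \<Omega> u) (wgrad \<Omega> u) + 2 * c * l2_inner \<Omega> (wgrad \<Omega> u) (wgrad \<Omega> w)
    + c\<^sup>2 * l2_inner \<Omega> (wgrad \<Omega> w) (wgrad \<Omega> w)"
proof -
  let ?v = "\<lambda>x. u x + c * w x"
  note L = l2_inner_wgrad_lincomb[OF \<Omega> u w]
  have "l2_inner \<Omega> (wgrad \<Omega> ?v) (wgrad \<Omega> ?v) =
      l2_inner \<Omega> (wgrad \<Omega> ?v) (wgrad \<Omega> u) + c * l2_inner \<Omega> (wgrad \<Omega> ?v) (wgrad \<Omega> w)"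
    using L[OF H1_lincomb[OF \<Omega> u w]] by (simp add: l2_inner_commute)
  also have "\<dots> = l2_inner \<Omega> (wgrad \<Omega> u) (wgrad \<Omega> u) + c * l2_inner \<Omega> (wgrad \<Omega> w) (wgrad \<Omega> u)
     + c * (l2_inner \<Omega> (wgrad \<Omega> u) (wgrad \<Omega> w) + c * l2_inner \<Omega> (wgrad \<Omega> w) (wgrad \<Omega> w))"
    by (simp only: L[OF u] L[OF w])
  finally show ?thesis
    unfolding l2_inner_commute[of \<Omega> "wgrad \<Omega> w" "wgrad \<Omega> u"]
    by (simp add: power2_eq_square algebra_simps)
qed

lemma weak_solution_lincomb:
  assumes \<Omega>: "open \<Omega>" and h: "h \<in> L2 (lebesgue_on \<Omega>)" "weak_solution \<Omega> \<Gamma> \<epsilon> h u"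
    and q: "q \<in> L2 (lebesgue_on \<Omega>)" "weak_solution \<Omega> \<Gamma> \<epsilon> q w"
  shows "weak_solution \<Omega> \<Gamma> \<epsilon> (\<lambda>x. h x + c * q x) (\<lambda>x. u x + c * w x)"
  unfolding weak_solution_def
proof (intro conjI ballI)
  have u: "u \<in> VD \<Omega> \<Gamma>" and w: "w \<in> VD \<Omega> \<Gamma>"
    using h q by (auto simp: weak_solution_def)
  then show "(\<lambda>x. u x + c * w x) \<in> VD \<Omega> \<Gamma>" by (rule VD_lincomb[OF \<Omega>])
  fix z assume z: "z \<in> VD \<Omega> \<Gamma>"
  have "\<epsilon> * l2_inner \<Omega> (wgrad \<Omega> u) (wgrad \<Omega> z) = l2_inner \<Omega> h z"
    "\<epsilon> * l2_inner \<Omega> (wgrad \<Omega> w) (wgrad \<Omega> z) = l2_inner \<Omega> q z"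
    using h q z by (auto simp: weak_solution_def l2_inner_scaleR)
  then show "l2_inner \<Omega> (\<lambda>x. \<epsilon> *\<^sub>R wgrad \<Omega> (\<lambda>x. u x + c * w x) x) (wgrad \<Omega> z) =
      l2_inner \<Omega> (\<lambda>x. h x + c * q x) z"
    unfolding l2_inner_scaleR l2_inner_wgrad_lincomb[OF \<Omega> VD_H1[OF u] VD_H1[OF w] VD_H1[OF z]]
      l2_inner_lincomb[OF h(1) q(1) H1_L2[OF VD_H1[OF z]]]
    by (simp add: algebra_simps)
qed

lemma weak_solution_cong_AE:
  assumes "h \<in> L2 (lebesgue_on \<Omega>)" "h' \<in> L2 (lebesgue_on \<Omega>)" "AE x in lebesgue_on \<Omega>. h x = h' x"
    and sol: "weak_solution \<Omega> \<Gamma> \<epsilon> h u"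
  shows "weak_solution \<Omega> \<Gamma> \<epsilon> h' u"
proof -
  have "l2_inner \<Omega> h w = l2_inner \<Omega> h' w" if "w \<in> VD \<Omega> \<Gamma>" for w
    unfolding l2_inner_def
  proof (rule integral_cong_AE)
    show "AE x in lebesgue_on \<Omega>. h x \<bullet> w x = h' x \<bullet> w x"
      using assms(3) by eventually_elim simp
  qed (use assms(1,2) H1_L2[OF VD_H1[OF that]] in \<open>auto dest!: L2_measurable\<close>)
  then show ?thesis
    using sol by (simp add: weak_solution_def)
qed

lemma wdiv_L2: "(\<And>i. P i \<in> H1 \<Omega>) \<Longrightarrow> wdiv \<Omega> P \<in> L2 (lebesgue_on \<Omega>)"
  unfolding wdiv_def[abs_def] by (intro L2_sum wpd_L2)

lemma potential_weak_solution:
  assumes "solution_operator \<Omega> \<Gamma> \<epsilon> \<Phi>" "\<rho> \<in> L2 (lebesgue_on \<Omega>)" "\<And>i. P i \<in> H1 \<Omega>"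
  shows "weak_solution \<Omega> \<Gamma> \<epsilon> (\<lambda>x. \<rho> x - wdiv \<Omega> P x) (potential \<Omega> \<Phi> \<rho> P)"
  using assms L2_diff[OF assms(2) wdiv_L2[of P \<Omega>]]
  by (simp add: solution_operator_def potential_def)

text \<open>
  The two potentials solve the same Poisson problem, up to a null set in the right-hand side, so
  they agree almost everywhere. Their gradients are equal as functions by \<open>wpd_cong_AE\<close>.
\<close>

lemma wgrad_potential_variation:
  assumes \<Omega>: "open \<Omega>" and \<Phi>: "solution_operator \<Omega> \<Gamma> \<epsilon> \<Phi>" and \<rho>: "\<rho> \<in> L2 (lebesgue_on \<Omega>)"
    and P: "\<And>i. P i \<in> H1 \<Omega>" and Q: "Q \<in> H1 \<Omega>"
  shows "wgrad \<Omega> (potential \<Omega> \<Phi> \<rho> (P(i := \<lambda>x. P i x + s * Q x))) =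
    wgrad \<Omega> (\<lambda>x. potential \<Omega> \<Phi> \<rho> P x + (- s) * \<Phi> (wpd \<Omega> Q i) x)"
proof -
  let ?M = "lebesgue_on \<Omega>"
  define P' where "P' = P(i := \<lambda>x. P i x + s * Q x)"
  have P'1: "P' j \<in> H1 \<Omega>" for j
    using P H1_lincomb[OF \<Omega> P Q] by (simp add: P'_def)
  let ?h = "\<lambda>x. \<rho> x - wdiv \<Omega> P x" and ?h' = "\<lambda>x. \<rho> x - wdiv \<Omega> P' x" and ?q = "wpd \<Omega> Q i"
  have L: "?h \<in> L2 ?M" "?h' \<in> L2 ?M" "?q \<in> L2 ?M"
    by (intro L2_diff \<rho> wdiv_L2 P P'1 wpd_L2 Q)+
  have "AE x in ?M. ?h x + (- s) * ?q x = ?h' x"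
    using wpd_lincomb[OF \<Omega> P[of i] Q, of s i]
  proof eventually_elim
    case (elim x)
    have "wdiv \<Omega> P' x = wpd \<Omega> (P' i) i x + (\<Sum>j\<in>UNIV - {i}. wpd \<Omega> (P' j) j x)"
      unfolding wdiv_def by (rule sum.remove) auto
    also have "(\<Sum>j\<in>UNIV - {i}. wpd \<Omega> (P' j) j x) = (\<Sum>j\<in>UNIV - {i}. wpd \<Omega> (P j) j x)"
      by (rule sum.cong) (auto simp: P'_def)
    also have "wpd \<Omega> (P' i) i x = s * wpd \<Omega> Q i x + wpd \<Omega> (P i) i x"
      using elim by (simp add: P'_def)
    also have "s * wpd \<Omega> Q i x + wpd \<Omega> (P i) i x + (\<Sum>j\<in>UNIV - {i}. wpd \<Omega> (P j) j x) =
        s * wpd \<Omega> Q i x + wdiv \<Omega> P x"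
      unfolding wdiv_def by (subst sum.remove[of UNIV i]) auto
    finally show ?case by simp
  qed
  moreover have sV: "weak_solution \<Omega> \<Gamma> \<epsilon> ?h (potential \<Omega> \<Phi> \<rho> P)"
    by (rule potential_weak_solution[OF \<Phi> \<rho> P])
  moreover have sW: "weak_solution \<Omega> \<Gamma> \<epsilon> ?q (\<Phi> ?q)"
    using \<Phi> L(3) by (simp add: solution_operator_def)
  ultimately have sol: "weak_solution \<Omega> \<Gamma> \<epsilon> ?h' (\<lambda>x. potential \<Omega> \<Phi> \<rho> P x + (- s) * \<Phi> ?q x)"
    using weak_solution_cong_AE[OF L2_lincomb[OF L(1,3)] L(2) _ weak_solution_lincomb[OF \<Omega> L(1) sV L(3) sW]]
    by blast
  have ae: "AE x in ?M. potential \<Omega> \<Phi> \<rho> P x + (- s) * \<Phi> ?q x = potential \<Omega> \<Phi> \<rho> P' x"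
    using \<Phi> L(2) sol unfolding solution_operator_def potential_def by blast
  have "potential \<Omega> \<Phi> \<rho> P' \<in> VD \<Omega> \<Gamma>"
    using potential_weak_solution[OF \<Phi> \<rho> P'1] by (simp add: weak_solution_def)
  moreover have "(\<lambda>x. potential \<Omega> \<Phi> \<rho> P x + (- s) * \<Phi> ?q x) \<in> VD \<Omega> \<Gamma>"
    using sol by (simp add: weak_solution_def)
  ultimately have "wpd \<Omega> (\<lambda>x. potential \<Omega> \<Phi> \<rho> P x + (- s) * \<Phi> ?q x) = wpd \<Omega> (potential \<Omega> \<Phi> \<rho> P')"
    by (intro wpd_cong_AE[OF _ _ ae \<Omega>] H1_L2 VD_H1)
  then show ?thesis
    by (simp add: P'_def[symmetric] wgrad_def fun_eq_iff)
qed

section \<open>The energies and their variation\<close>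

text \<open>
  By the binomial theorem the integral is a polynomial in \<open>s\<close>, whose coefficients are integrals of
  monomials in \<open>p\<close> and \<open>q\<close>; its derivative at \<open>0\<close> is the linear coefficient.
\<close>

lemma
  fixes p q :: "'a \<Rightarrow> real"
  assumes p: "p \<in> L2 M" "integrable M (\<lambda>x. p x ^ 6)" and q: "q \<in> L2 M" "integrable M (\<lambda>x. q x ^ 6)"
    and n: "2 \<le> n" "n \<le> 6"
  shows integrable_power_variation: "integrable M (\<lambda>x. (p x + s * q x) ^ n)"
    and DERIV_integral_power: "((\<lambda>s. LINT x|M. (p x + s * q x) ^ n) has_real_derivative
      real n * (LINT x|M. p x ^ (n - 1) * q x)) (at 0)"
proof -
  define m where "m k = (LINT x|M. p x ^ k * q x ^ (n - k))" for k
  have i: "integrable M (\<lambda>x. p x ^ k * q x ^ (n - k))" if "k \<le> n" for k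
    using that n by (intro integrable_monomial p q) auto
  have ex: "(a + s * b) ^ n = (\<Sum>k\<le>n. real (n choose k) * s ^ (n - k) * (a ^ k * b ^ (n - k)))" for a b s :: real
    by (simp add: binomial_ring power_mult_distrib mult_ac)
  show "integrable M (\<lambda>x. (p x + s * q x) ^ n)" for s
    unfolding ex by (intro Bochner_Integration.integrable_sum integrable_mult_right i) simp
  have eq: "(LINT x|M. (p x + s * q x) ^ n) = (\<Sum>k\<le>n. real (n choose k) * s ^ (n - k) * m k)" for s
    unfolding ex m_def
    by (subst Bochner_Integration.integral_sum) (auto intro!: integrable_mult_right i)
  have "((\<lambda>s. \<Sum>k\<le>n. real (n choose k) * s ^ (n - k) * m k) has_real_derivative
      (\<Sum>k\<le>n. real (n choose k) * (if n - k = 1 then 1 else 0) * m k)) (at 0)"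
  proof (rule DERIV_sum)
    fix k
    have "((\<lambda>s. s ^ (n - k)) has_real_derivative (if n - k = 1 then 1 else 0)) (at 0)"
      by (rule DERIV_cong[OF DERIV_pow]) (auto simp: power_0_left)
    then show "((\<lambda>s. real (n choose k) * s ^ (n - k) * m k) has_real_derivative
        real (n choose k) * (if n - k = 1 then 1 else 0) * m k) (at 0)"
      by (intro DERIV_cmult_right DERIV_cmult)
  qed
  also have "(\<Sum>k\<le>n. real (n choose k) * (if n - k = 1 then 1 else 0) * m k) =
      (\<Sum>k\<le>n. if k = n - 1 then real (n choose k) * m k else 0)"
    using n by (intro sum.cong) auto
  also have "\<dots> = real n * m (n - 1)"
    using n binomial_symmetric[of "n - 1" n] by (simp add: sum.delta)
  also have "m (n - 1) = (LINT x|M. p x ^ (n - 1) * q x)"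
    using n by (simp add: m_def)
  finally show "((\<lambda>s. LINT x|M. (p x + s * q x) ^ n) has_real_derivative
      real n * (LINT x|M. p x ^ (n - 1) * q x)) (at 0)"
    unfolding eq .
qed

lemma integrable_F:
  assumes "u \<in> L2 M" "integrable M (\<lambda>x. u x ^ 6)"
  shows "integrable M (\<lambda>x. F a b c (u x))"
  using integrable_power_variation[OF assms assms, of _ 0] unfolding F_def
  by (intro Bochner_Integration.integrable_add integrable_mult_right) simp_all

lemma DERIV_integral_F:
  fixes p q :: "'a \<Rightarrow> real"
  assumes p: "p \<in> L2 M" "integrable M (\<lambda>x. p x ^ 6)" and q: "q \<in> L2 M" "integrable M (\<lambda>x. q x ^ 6)"
  shows "((\<lambda>s. LINT x|M. F a b c (p x + s * q x)) has_real_derivative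
    (LINT x|M. DF a b c (p x) * p x * q x)) (at 0)"
proof -
  note I = integrable_power_variation[OF p q]
  have eq: "(LINT x|M. F a b c (p x + s * q x)) = a * (LINT x|M. (p x + s * q x) ^ 2)
      + b * (LINT x|M. (p x + s * q x) ^ 4) + c * (LINT x|M. (p x + s * q x) ^ 6)" for s
    unfolding F_def using I[of 2 s] I[of 4 s] I[of 6 s] by simp
  have J: "integrable M (\<lambda>x. p x ^ k * q x)" if "1 \<le> k" "k \<le> 5" for k
    using integrable_monomial[OF p q, of k 1] that by simp
  have "(LINT x|M. DF a b c (p x) * p x * q x) =
      (LINT x|M. a * (2 * (p x ^ 1 * q x)) + b * (4 * (p x ^ 3 * q x)) + c * (6 * (p x ^ 5 * q x)))"
    by (intro Bochner_Integration.integral_cong) (simp_all add: DF_def algebra_simps eval_nat_numeral)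
  also have "\<dots> = a * (2 * (LINT x|M. p x ^ 1 * q x)) + b * (4 * (LINT x|M. p x ^ 3 * q x))
      + c * (6 * (LINT x|M. p x ^ 5 * q x))"
    using J[of 1] J[of 3] J[of 5] by simp
  finally have D: "(LINT x|M. DF a b c (p x) * p x * q x) = \<dots>" .
  show ?thesis
    unfolding eq D
    by (intro DERIV_add DERIV_cmult)
      (use DERIV_integral_power[OF p q, of 2] DERIV_integral_power[OF p q, of 4]
         DERIV_integral_power[OF p q, of 6] in simp_all)
qed

lemma modified_energy_eq:
  assumes V: "potential \<Omega> \<Phi> \<rho> P \<in> H1 \<Omega>" and P: "\<And>i. P i \<in> H1 \<Omega>"
    and P6: "\<And>i. integrable (lebesgue_on \<Omega>) (\<lambda>x. P i x ^ 6)"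
  shows "modified_energy \<Omega> \<epsilon> \<Phi> \<rho> \<alpha> \<beta> \<gamma> g P =
    \<epsilon> / 2 * l2_inner \<Omega> (wgrad \<Omega> (potential \<Omega> \<Phi> \<rho> P)) (wgrad \<Omega> (potential \<Omega> \<Phi> \<rho> P))
    + (\<Sum>i\<in>UNIV. (LINT x|lebesgue_on \<Omega>. F (\<alpha> i) (\<beta> i) (\<gamma> i) (P i x))
        + g i / 2 * l2_inner \<Omega> (wgrad \<Omega> (P i)) (wgrad \<Omega> (P i)))"
proof -
  have "integrable (lebesgue_on \<Omega>) (\<lambda>x. F (\<alpha> i) (\<beta> i) (\<gamma> i) (P i x))" for i
    by (intro integrable_F H1_L2 P P6)
  then show ?thesis
    unfolding modified_energy_def l2_inner_def power2_norm_eq_inner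
    by (simp add: integrable_wgrad_inner V P sum.distrib)
qed

lemma gibbs_energy_eq:
  assumes \<rho>: "\<rho> \<in> L2 (lebesgue_on \<Omega>)" and V: "V \<in> H1 \<Omega>" and P: "\<And>i. P i \<in> H1 \<Omega>"
    and P6: "\<And>i. integrable (lebesgue_on \<Omega>) (\<lambda>x. P i x ^ 6)"
  shows "gibbs_energy \<Omega> \<epsilon> \<rho> \<alpha> \<beta> \<gamma> g V P =
    l2_inner \<Omega> \<rho> V + (\<Sum>i\<in>UNIV. l2_inner \<Omega> (P i) (wpd \<Omega> V i))
    - \<epsilon> / 2 * l2_inner \<Omega> (wgrad \<Omega> V) (wgrad \<Omega> V)
    + (\<Sum>i\<in>UNIV. (LINT x|lebesgue_on \<Omega>. F (\<alpha> i) (\<beta> i) (\<gamma> i) (P i x))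
        + g i / 2 * l2_inner \<Omega> (wgrad \<Omega> (P i)) (wgrad \<Omega> (P i)))"
proof -
  let ?M = "lebesgue_on \<Omega>"
  have F: "integrable ?M (\<lambda>x. F (\<alpha> i) (\<beta> i) (\<gamma> i) (P i x))" for i
    by (intro integrable_F H1_L2 P P6)
  have PV: "integrable ?M (\<lambda>x. P i x * wpd \<Omega> V i x)" for i
    by (intro L2_integrable_mult H1_L2 P wpd_L2 V)
  have \<rho>V: "integrable ?M (\<lambda>x. \<rho> x * V x)"
    by (intro L2_integrable_mult \<rho> H1_L2 V)
  have dot: "(\<chi> i. P i x) \<bullet> wgrad \<Omega> V x = (\<Sum>i\<in>UNIV. P i x * wpd \<Omega> V i x)" for x
    by (simp add: inner_vec_def wgrad_def)
  show ?thesis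
    unfolding gibbs_energy_def l2_inner_def power2_norm_eq_inner dot inner_real_def
    by (simp add: integrable_wgrad_inner V P F PV \<rho>V)
qed

text \<open>
  The form of the right-hand side of the Poisson problem that appears in the Gibbs energy.
\<close>

lemma l2_inner_charge_potential:
  assumes \<Omega>: "open \<Omega>" and \<rho>: "\<rho> \<in> L2 (lebesgue_on \<Omega>)" and P: "\<And>i. P i \<in> H10 \<Omega>" and V: "V \<in> H1 \<Omega>"
  shows "l2_inner \<Omega> (\<lambda>x. \<rho> x - wdiv \<Omega> P x) V =
    l2_inner \<Omega> \<rho> V + (\<Sum>i\<in>UNIV. l2_inner \<Omega> (P i) (wpd \<Omega> V i))"
proof -
  have i: "integrable (lebesgue_on \<Omega>) (\<lambda>x. \<rho> x * V x)"
    "integrable (lebesgue_on \<Omega>) (\<lambda>x. wpd \<Omega> (P i) i x * V x)" for i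
    by (intro L2_integrable_mult \<rho> H1_L2 V wpd_L2 H10_H1 P)+
  have "l2_inner \<Omega> (\<lambda>x. \<rho> x - wdiv \<Omega> P x) V =
      (LINT x|lebesgue_on \<Omega>. \<rho> x * V x - (\<Sum>i\<in>UNIV. wpd \<Omega> (P i) i x * V x))"
    by (simp add: l2_inner_def wdiv_def left_diff_distrib sum_distrib_right)
  also have "\<dots> = l2_inner \<Omega> \<rho> V - (\<Sum>i\<in>UNIV. l2_inner \<Omega> (wpd \<Omega> (P i) i) V)"
    by (simp add: l2_inner_def i)
  also have "\<dots> = l2_inner \<Omega> \<rho> V + (\<Sum>i\<in>UNIV. l2_inner \<Omega> (P i) (wpd \<Omega> V i))"
    by (simp add: integration_by_parts_H10[OF \<Omega> P V] sum_negf)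
  finally show ?thesis .
qed

text \<open>
  Test the Poisson problem for \<open>V\<close> with \<open>V\<close> itself.
\<close>

lemma modified_energy_eq_gibbs_energy:
  fixes \<Omega> :: "(real^'n) set"
  assumes card: "CARD('n) \<le> 3" and \<Omega>: "open \<Omega>" and \<Phi>: "solution_operator \<Omega> \<Gamma> \<epsilon> \<Phi>"
    and \<rho>: "\<rho> \<in> L2 (lebesgue_on \<Omega>)" and P: "\<And>i. P i \<in> H10 \<Omega>"
  shows "modified_energy \<Omega> \<epsilon> \<Phi> \<rho> \<alpha> \<beta> \<gamma> g P = gibbs_energy \<Omega> \<epsilon> \<rho> \<alpha> \<beta> \<gamma> g (potential \<Omega> \<Phi> \<rho> P) P"
proof -
  let ?V = "potential \<Omega> \<Phi> \<rho> P"
  have P1: "P i \<in> H1 \<Omega>" for i by (rule H10_H1[OF P])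
  have sol: "weak_solution \<Omega> \<Gamma> \<epsilon> (\<lambda>x. \<rho> x - wdiv \<Omega> P x) ?V"
    by (rule potential_weak_solution[OF \<Phi> \<rho> P1])
  then have VD: "?V \<in> VD \<Omega> \<Gamma>" by (simp add: weak_solution_def)
  have V: "?V \<in> H1 \<Omega>" by (rule VD_H1[OF VD])
  have "\<epsilon> * l2_inner \<Omega> (wgrad \<Omega> ?V) (wgrad \<Omega> ?V) =
      l2_inner \<Omega> \<rho> ?V + (\<Sum>i\<in>UNIV. l2_inner \<Omega> (P i) (wpd \<Omega> ?V i))"
    using sol VD l2_inner_charge_potential[OF \<Omega> \<rho> P V]
    by (simp add: weak_solution_def l2_inner_scaleR)
  then show ?thesis
    unfolding modified_energy_eq[where P = P, OF V P1 H10_integrable_power6[OF card \<Omega> P]]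
      gibbs_energy_eq[where P = P, OF \<rho> V P1 H10_integrable_power6[OF card \<Omega> P]]
    by linarith
qed

text \<open>
  All terms are polynomials in the step size \<open>s\<close>. The linear coefficient of the electric energy is
  found by testing the problem for \<open>W\<close>, the response of the potential, with \<open>V\<close>.
\<close>

lemma modified_energy_has_partial_variation:
  fixes \<Omega> :: "(real^'n) set"
  assumes card: "CARD('n) \<le> 3" and \<Omega>: "open \<Omega>" and \<Phi>: "solution_operator \<Omega> \<Gamma> \<epsilon> \<Phi>"
    and \<rho>: "\<rho> \<in> L2 (lebesgue_on \<Omega>)" and P: "\<And>i. P i \<in> H10 \<Omega>" and Q: "Q \<in> H10 \<Omega>"
  shows "has_partial_variation (modified_energy \<Omega> \<epsilon> \<Phi> \<rho> \<alpha> \<beta> \<gamma> g) P i Q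
    (l2_inner \<Omega> (wpd \<Omega> (potential \<Omega> \<Phi> \<rho> P) i) Q
     + l2_inner \<Omega> (\<lambda>x. DF (\<alpha> i) (\<beta> i) (\<gamma> i) (P i x) * P i x) Q
     + g i * l2_inner \<Omega> (wgrad \<Omega> (P i)) (wgrad \<Omega> Q))"
  unfolding has_partial_variation_def
proof -
  let ?V = "potential \<Omega> \<Phi> \<rho> P" and ?q = "wpd \<Omega> Q i"
  let ?D = "\<lambda>u w. l2_inner \<Omega> (wgrad \<Omega> u) (wgrad \<Omega> w)"
  let ?F = "\<lambda>j u. LINT x|lebesgue_on \<Omega>. F (\<alpha> j) (\<beta> j) (\<gamma> j) (u x)"
  define W where "W = \<Phi> ?q"
  define P' where "P' s = P(i := \<lambda>x. P i x + s * Q x)" for s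
  have P1: "P j \<in> H1 \<Omega>" for j by (rule H10_H1[OF P])
  have Q1: "Q \<in> H1 \<Omega>" by (rule H10_H1[OF Q])
  have P': "P' s j \<in> H10 \<Omega>" for s j
    using P H10_lincomb[OF \<Omega> P Q] by (simp add: P'_def)
  have P'1: "P' s j \<in> H1 \<Omega>" for s j by (rule H10_H1[OF P'])
  have VD: "potential \<Omega> \<Phi> \<rho> R \<in> VD \<Omega> \<Gamma>" if "\<And>j. R j \<in> H1 \<Omega>" for R
    using potential_weak_solution[where P = R, OF \<Phi> \<rho> that] by (simp add: weak_solution_def)
  have V: "?V \<in> H1 \<Omega>" by (rule VD_H1[OF VD[of P, OF P1]])
  have solW: "weak_solution \<Omega> \<Gamma> \<epsilon> ?q W"
    using \<Phi> wpd_L2[OF Q1, of i] by (simp add: solution_operator_def W_def)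
  then have W: "W \<in> H1 \<Omega>" by (auto simp: weak_solution_def VD_H1)
  have VW: "\<epsilon> * ?D ?V W = - l2_inner \<Omega> (wpd \<Omega> ?V i) Q"
  proof -
    have "\<epsilon> * ?D W ?V = l2_inner \<Omega> ?q ?V"
      using solW VD[of P, OF P1] by (simp add: weak_solution_def l2_inner_scaleR)
    then show ?thesis
      using integration_by_parts_H10[OF \<Omega> Q V, of i]
      by (simp add: l2_inner_commute[of \<Omega> "wgrad \<Omega> ?V"] l2_inner_commute[of \<Omega> "wpd \<Omega> ?V i"])
  qed
  \<comment> \<open>the part of the energy that does not depend on \<open>s\<close>\<close>
  define C where "C = (\<Sum>j\<in>UNIV - {i}. ?F j (P j) + g j / 2 * ?D (P j) (P j))"
  have E: "modified_energy \<Omega> \<epsilon> \<Phi> \<rho> \<alpha> \<beta> \<gamma> g (P' s) =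
      \<epsilon> / 2 * (?D ?V ?V + 2 * (- s) * ?D ?V W + (- s)\<^sup>2 * ?D W W)
      + (?F i (\<lambda>x. P i x + s * Q x) + g i / 2 * (?D (P i) (P i) + 2 * s * ?D (P i) Q + s\<^sup>2 * ?D Q Q) + C)" for s
  proof -
    have "(\<Sum>j\<in>UNIV. ?F j (P' s j) + g j / 2 * ?D (P' s j) (P' s j)) =
        ?F i (P' s i) + g i / 2 * ?D (P' s i) (P' s i)
        + (\<Sum>j\<in>UNIV - {i}. ?F j (P' s j) + g j / 2 * ?D (P' s j) (P' s j))"
      by (rule sum.remove) auto
    also have "(\<Sum>j\<in>UNIV - {i}. ?F j (P' s j) + g j / 2 * ?D (P' s j) (P' s j)) = C"
      unfolding C_def by (rule sum.cong) (auto simp: P'_def)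
    also have "P' s i = (\<lambda>x. P i x + s * Q x)" by (simp add: P'_def)
    finally have "(\<Sum>j\<in>UNIV. ?F j (P' s j) + g j / 2 * ?D (P' s j) (P' s j)) =
        ?F i (\<lambda>x. P i x + s * Q x) + g i / 2 * (?D (P i) (P i) + 2 * s * ?D (P i) Q + s\<^sup>2 * ?D Q Q) + C"
      by (simp only: Dirichlet_integral_lincomb[OF \<Omega> P1 Q1])
    moreover have "wgrad \<Omega> (potential \<Omega> \<Phi> \<rho> (P' s)) = wgrad \<Omega> (\<lambda>x. ?V x + (- s) * W x)"
      unfolding P'_def W_def by (rule wgrad_potential_variation[OF \<Omega> \<Phi> \<rho> P1 Q1])
    ultimately show ?thesis
      using modified_energy_eq[OF VD_H1[OF VD[of "P' s", OF P'1]] P'1 H10_integrable_power6[OF card \<Omega> P'],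
          of \<epsilon> \<alpha> \<beta> \<gamma> g]
      by (simp only: Dirichlet_integral_lincomb[OF \<Omega> V W])
  qed
  have "((\<lambda>s. ?F i (\<lambda>x. P i x + s * Q x)) has_real_derivative
      l2_inner \<Omega> (\<lambda>x. DF (\<alpha> i) (\<beta> i) (\<gamma> i) (P i x) * P i x) Q) (at 0)"
    using DERIV_integral_F[OF H1_L2[OF P1] H10_integrable_power6[OF card \<Omega> P]
        H1_L2[OF Q1] H10_integrable_power6[OF card \<Omega> Q]]
    by (simp add: l2_inner_def)
  moreover have "((\<lambda>s. \<epsilon> / 2 * (?D ?V ?V + 2 * (- s) * ?D ?V W + (- s)\<^sup>2 * ?D W W)) has_real_derivative
      - (\<epsilon> * ?D ?V W)) (at 0)"
    by (auto intro!: derivative_eq_intros)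
  moreover have "((\<lambda>s. g i / 2 * (?D (P i) (P i) + 2 * s * ?D (P i) Q + s\<^sup>2 * ?D Q Q)) has_real_derivative
      g i * ?D (P i) Q) (at 0)"
    by (auto intro!: derivative_eq_intros)
  ultimately have "((\<lambda>s. modified_energy \<Omega> \<epsilon> \<Phi> \<rho> \<alpha> \<beta> \<gamma> g (P' s)) has_real_derivative
      - (\<epsilon> * ?D ?V W) + (l2_inner \<Omega> (\<lambda>x. DF (\<alpha> i) (\<beta> i) (\<gamma> i) (P i x) * P i x) Q + g i * ?D (P i) Q + 0)) (at 0)"
    unfolding E by (intro DERIV_add DERIV_const)
  then show "((\<lambda>s. modified_energy \<Omega> \<epsilon> \<Phi> \<rho> \<alpha> \<beta> \<gamma> g (P(i := \<lambda>x. P i x + s * Q x))) has_real_derivative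
      l2_inner \<Omega> (wpd \<Omega> ?V i) Q + l2_inner \<Omega> (\<lambda>x. DF (\<alpha> i) (\<beta> i) (\<gamma> i) (P i x) * P i x) Q
      + g i * ?D (P i) Q) (at 0)"
    by (simp add: VW P'_def add.assoc)
qed

theorem proposition2p1:
  fixes \<Omega> \<Gamma>D \<Gamma>N :: "(real^'n) set"
    and \<epsilon> :: real
    and \<rho> :: "real^'n \<Rightarrow> real"
    and \<alpha> \<beta> \<gamma> g \<eta> :: "'n \<Rightarrow> real"
    and \<Phi> :: "(real^'n \<Rightarrow> real) \<Rightarrow> real^'n \<Rightarrow> real"
  assumes "CARD('n) \<le> 3"
    and "open \<Omega>" and "connected \<Omega>" and "\<Omega> \<noteq> {}" and "bounded \<Omega>" and "lipschitz_boundary \<Omega>"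
    and "frontier \<Omega> = \<Gamma>D \<union> \<Gamma>N" and "\<Gamma>D \<inter> \<Gamma>N = {}"
    and "\<Gamma>D \<in> sets (completion surface_measure)"
    and "emeasure (completion surface_measure) \<Gamma>D > 0"
    and "\<epsilon> > 0"
    and "\<rho> \<in> L2 (lebesgue_on \<Omega>)"
    and "solution_operator \<Omega> \<Gamma>D \<epsilon> \<Phi>"
    and "\<And>i. dielectric (\<alpha> i) (\<beta> i) (\<gamma> i) (g i) \<or> ferroelectric (\<alpha> i) (\<beta> i) (\<gamma> i) (g i)"
    and "\<And>i. dielectric (\<alpha> i) (\<beta> i) (\<gamma> i) (g i) \<Longrightarrow> \<eta> i = 0"
    and "\<And>i. ferroelectric (\<alpha> i) (\<beta> i) (\<gamma> i) (g i) \<Longrightarrow> \<eta> i > 0"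
  shows
    "(\<forall>P. (\<forall>i. P i \<in> H10 \<Omega>) \<longrightarrow>
        modified_energy \<Omega> \<epsilon> \<Phi> \<rho> \<alpha> \<beta> \<gamma> g P =
        gibbs_energy \<Omega> \<epsilon> \<rho> \<alpha> \<beta> \<gamma> g (potential \<Omega> \<Phi> \<rho> P) P)
     \<and>
     (\<forall>J P dtP. open J \<and> is_interval J \<and>
        (\<forall>t\<in>J. \<forall>i. P t i \<in> H10 \<Omega>) \<and>
        (\<forall>t\<in>J. \<forall>i. ferroelectric (\<alpha> i) (\<beta> i) (\<gamma> i) (g i) \<longrightarrow>
           has_L2_time_derivative \<Omega> (\<lambda>s. P s i) (dtP t i) t) \<longrightarrow>
        (weak_gradient_flow \<Omega> (modified_energy \<Omega> \<epsilon> \<Phi> \<rho> \<alpha> \<beta> \<gamma> g) \<eta> J P dtP \<longleftrightarrow>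
         (\<forall>t\<in>J. let V = potential \<Omega> \<Phi> \<rho> (P t) in
            (\<forall>w\<in>VD \<Omega> \<Gamma>D.
               - l2_inner \<Omega> (\<lambda>x. \<epsilon> *\<^sub>R wgrad \<Omega> V x) (wgrad \<Omega> w)
               + l2_inner \<Omega> (\<lambda>x. \<rho> x - wdiv \<Omega> (P t) x) w = 0) \<and>
            (\<forall>i. dielectric (\<alpha> i) (\<beta> i) (\<gamma> i) (g i) \<longrightarrow>
               (\<forall>Q\<in>H10 \<Omega>. 2 * \<alpha> i * l2_inner \<Omega> (P t i) Q + l2_inner \<Omega> (wpd \<Omega> V i) Q = 0)) \<and>
            (\<forall>i. ferroelectric (\<alpha> i) (\<beta> i) (\<gamma> i) (g i) \<longrightarrow>
               (\<forall>Q\<in>H10 \<Omega>.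
                  \<eta> i * l2_inner \<Omega> (dtP t i) Q
                  + g i * l2_inner \<Omega> (wgrad \<Omega> (P t i)) (wgrad \<Omega> Q)
                  + l2_inner \<Omega> (\<lambda>x. DF (\<alpha> i) (\<beta> i) (\<gamma> i) (P t i x) * P t i x) Q
                  + l2_inner \<Omega> (wpd \<Omega> V i) Q = 0)))))"
proof -
  let ?I = "modified_energy \<Omega> \<epsilon> \<Phi> \<rho> \<alpha> \<beta> \<gamma> g"
  note \<Omega> = \<open>open \<Omega>\<close> and \<rho> = \<open>\<rho> \<in> L2 (lebesgue_on \<Omega>)\<close>
    and \<Phi> = \<open>solution_operator \<Omega> \<Gamma>D \<epsilon> \<Phi>\<close> and card = \<open>CARD('n) \<le> 3\<close>
  \<comment> \<open>the variation exists and is unique, so the existential quantifier of the flow can be eliminated\<close>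
  have flow: "weak_gradient_flow \<Omega> ?I \<eta> J P dtP \<longleftrightarrow>
      (\<forall>t\<in>J. \<forall>i. \<forall>Q\<in>H10 \<Omega>. \<eta> i * l2_inner \<Omega> (dtP t i) Q
        + g i * l2_inner \<Omega> (wgrad \<Omega> (P t i)) (wgrad \<Omega> Q)
        + l2_inner \<Omega> (\<lambda>x. DF (\<alpha> i) (\<beta> i) (\<gamma> i) (P t i x) * P t i x) Q
        + l2_inner \<Omega> (wpd \<Omega> (potential \<Omega> \<Phi> \<rho> (P t)) i) Q = 0)"
    if P: "\<forall>t\<in>J. \<forall>i. P t i \<in> H10 \<Omega>" for J and P dtP :: "real \<Rightarrow> 'n \<Rightarrow> real^'n \<Rightarrow> real"
    unfolding weak_gradient_flow_def
  proof (intro ball_cong all_cong1 refl)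
    fix t i Q assume t: "t \<in> J" and Q: "Q \<in> H10 \<Omega>"
    let ?D = "l2_inner \<Omega> (wpd \<Omega> (potential \<Omega> \<Phi> \<rho> (P t)) i) Q
     + l2_inner \<Omega> (\<lambda>x. DF (\<alpha> i) (\<beta> i) (\<gamma> i) (P t i x) * P t i x) Q
     + g i * l2_inner \<Omega> (wgrad \<Omega> (P t i)) (wgrad \<Omega> Q)"
    have D: "has_partial_variation ?I (P t) i Q ?D"
      by (rule modified_energy_has_partial_variation[OF card \<Omega> \<Phi> \<rho> _ Q]) (use P t in blast)
    then have "has_partial_variation ?I (P t) i Q D' \<longleftrightarrow> D' = ?D" for D'
      unfolding has_partial_variation_def using DERIV_unique by blast
    then have "(\<exists>D'. has_partial_variation ?I (P t) i Q D' \<and> \<eta> i * l2_inner \<Omega> (dtP t i) Q = - D') \<longleftrightarrow>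
        \<eta> i * l2_inner \<Omega> (dtP t i) Q = - ?D"
      by simp
    also have "\<dots> \<longleftrightarrow> \<eta> i * l2_inner \<Omega> (dtP t i) Q
        + g i * l2_inner \<Omega> (wgrad \<Omega> (P t i)) (wgrad \<Omega> Q)
        + l2_inner \<Omega> (\<lambda>x. DF (\<alpha> i) (\<beta> i) (\<gamma> i) (P t i x) * P t i x) Q
        + l2_inner \<Omega> (wpd \<Omega> (potential \<Omega> \<Phi> \<rho> (P t)) i) Q = 0"
      by linarith
    finally show "(\<exists>D'. has_partial_variation ?I (P t) i Q D' \<and> \<eta> i * l2_inner \<Omega> (dtP t i) Q = - D') \<longleftrightarrow>
        \<eta> i * l2_inner \<Omega> (dtP t i) Q
        + g i * l2_inner \<Omega> (wgrad \<Omega> (P t i)) (wgrad \<Omega> Q)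
        + l2_inner \<Omega> (\<lambda>x. DF (\<alpha> i) (\<beta> i) (\<gamma> i) (P t i x) * P t i x) Q
        + l2_inner \<Omega> (wpd \<Omega> (potential \<Omega> \<Phi> \<rho> (P t)) i) Q = 0" .
  qed
  have poisson: "- l2_inner \<Omega> (\<lambda>x. \<epsilon> *\<^sub>R wgrad \<Omega> (potential \<Omega> \<Phi> \<rho> P) x) (wgrad \<Omega> w)
      + l2_inner \<Omega> (\<lambda>x. \<rho> x - wdiv \<Omega> P x) w = 0"
    if "\<And>i. P i \<in> H10 \<Omega>" "w \<in> VD \<Omega> \<Gamma>D" for P w
    using potential_weak_solution[where P = P, OF \<Phi> \<rho> H10_H1[OF that(1)]] that(2)
    by (simp add: weak_solution_def)
  have dielectric_terms: "\<eta> i * l2_inner \<Omega> z Q + g i * l2_inner \<Omega> (wgrad \<Omega> p) (wgrad \<Omega> Q)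
        + l2_inner \<Omega> (\<lambda>x. DF (\<alpha> i) (\<beta> i) (\<gamma> i) (p x) * p x) Q = 2 * \<alpha> i * l2_inner \<Omega> p Q"
    if "dielectric (\<alpha> i) (\<beta> i) (\<gamma> i) (g i)" for i and p z Q :: "real^'n \<Rightarrow> real"
  proof -
    have "\<eta> i = 0" "g i = 0" "\<beta> i = 0" "\<gamma> i = 0"
      using that assms(15) by (auto simp: dielectric_def)
    then show ?thesis
      by (simp add: DF_def l2_inner_def mult.assoc)
  qed
  show ?thesis
  proof (intro conjI allI impI)
    fix P :: "'n \<Rightarrow> real^'n \<Rightarrow> real" assume "\<forall>i. P i \<in> H10 \<Omega>"
    then show "?I P = gibbs_energy \<Omega> \<epsilon> \<rho> \<alpha> \<beta> \<gamma> g (potential \<Omega> \<Phi> \<rho> P) P"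
      by (intro modified_energy_eq_gibbs_energy[OF card \<Omega> \<Phi> \<rho>]) simp
  next
    fix J :: "real set" and P dtP :: "real \<Rightarrow> 'n \<Rightarrow> real^'n \<Rightarrow> real"
    assume "open J \<and> is_interval J \<and> (\<forall>t\<in>J. \<forall>i. P t i \<in> H10 \<Omega>) \<and>
      (\<forall>t\<in>J. \<forall>i. ferroelectric (\<alpha> i) (\<beta> i) (\<gamma> i) (g i) \<longrightarrow>
           has_L2_time_derivative \<Omega> (\<lambda>s. P s i) (dtP t i) t)"
    then have P: "\<forall>t\<in>J. \<forall>i. P t i \<in> H10 \<Omega>"
      by blast
    show "weak_gradient_flow \<Omega> ?I \<eta> J P dtP \<longleftrightarrow>
         (\<forall>t\<in>J. let V = potential \<Omega> \<Phi> \<rho> (P t) in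
            (\<forall>w\<in>VD \<Omega> \<Gamma>D.
               - l2_inner \<Omega> (\<lambda>x. \<epsilon> *\<^sub>R wgrad \<Omega> V x) (wgrad \<Omega> w)
               + l2_inner \<Omega> (\<lambda>x. \<rho> x - wdiv \<Omega> (P t) x) w = 0) \<and>
            (\<forall>i. dielectric (\<alpha> i) (\<beta> i) (\<gamma> i) (g i) \<longrightarrow>
               (\<forall>Q\<in>H10 \<Omega>. 2 * \<alpha> i * l2_inner \<Omega> (P t i) Q + l2_inner \<Omega> (wpd \<Omega> V i) Q = 0)) \<and>
            (\<forall>i. ferroelectric (\<alpha> i) (\<beta> i) (\<gamma> i) (g i) \<longrightarrow>
               (\<forall>Q\<in>H10 \<Omega>.
                  \<eta> i * l2_inner \<Omega> (dtP t i) Q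
                  + g i * l2_inner \<Omega> (wgrad \<Omega> (P t i)) (wgrad \<Omega> Q)
                  + l2_inner \<Omega> (\<lambda>x. DF (\<alpha> i) (\<beta> i) (\<gamma> i) (P t i x) * P t i x) Q
                  + l2_inner \<Omega> (wpd \<Omega> V i) Q = 0)))"
      unfolding flow[OF P] Let_def
    proof (rule ball_cong[OF refl])
      fix t assume t: "t \<in> J"
      let ?e = "\<lambda>i Q. \<eta> i * l2_inner \<Omega> (dtP t i) Q
                  + g i * l2_inner \<Omega> (wgrad \<Omega> (P t i)) (wgrad \<Omega> Q)
                  + l2_inner \<Omega> (\<lambda>x. DF (\<alpha> i) (\<beta> i) (\<gamma> i) (P t i x) * P t i x) Q
                  + l2_inner \<Omega> (wpd \<Omega> (potential \<Omega> \<Phi> \<rho> (P t)) i) Q"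
      have di: "?e i Q = 2 * \<alpha> i * l2_inner \<Omega> (P t i) Q + l2_inner \<Omega> (wpd \<Omega> (potential \<Omega> \<Phi> \<rho> (P t)) i) Q"
        if "dielectric (\<alpha> i) (\<beta> i) (\<gamma> i) (g i)" for i Q
        by (simp only: dielectric_terms[OF that])
      show "(\<forall>i. \<forall>Q\<in>H10 \<Omega>. ?e i Q = 0) \<longleftrightarrow>
            (\<forall>w\<in>VD \<Omega> \<Gamma>D.
               - l2_inner \<Omega> (\<lambda>x. \<epsilon> *\<^sub>R wgrad \<Omega> (potential \<Omega> \<Phi> \<rho> (P t)) x) (wgrad \<Omega> w)
               + l2_inner \<Omega> (\<lambda>x. \<rho> x - wdiv \<Omega> (P t) x) w = 0) \<and>
            (\<forall>i. dielectric (\<alpha> i) (\<beta> i) (\<gamma> i) (g i) \<longrightarrow>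
               (\<forall>Q\<in>H10 \<Omega>. 2 * \<alpha> i * l2_inner \<Omega> (P t i) Q
                  + l2_inner \<Omega> (wpd \<Omega> (potential \<Omega> \<Phi> \<rho> (P t)) i) Q = 0)) \<and>
            (\<forall>i. ferroelectric (\<alpha> i) (\<beta> i) (\<gamma> i) (g i) \<longrightarrow> (\<forall>Q\<in>H10 \<Omega>. ?e i Q = 0))"
        (is "?all \<longleftrightarrow> ?poisson \<and> ?diel \<and> ?ferro")
      proof -
        have "?poisson"
          using poisson[of "P t"] P t by blast
        moreover have "?all \<longleftrightarrow> (\<forall>i. dielectric (\<alpha> i) (\<beta> i) (\<gamma> i) (g i) \<longrightarrow> (\<forall>Q\<in>H10 \<Omega>. ?e i Q = 0)) \<and> ?ferro"
          using assms(14) by blast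
        moreover have "(\<forall>i. dielectric (\<alpha> i) (\<beta> i) (\<gamma> i) (g i) \<longrightarrow> (\<forall>Q\<in>H10 \<Omega>. ?e i Q = 0)) \<longleftrightarrow> ?diel"
          by (intro all_cong1 imp_cong refl) (simp only: di)
        ultimately show ?thesis
          by blast
      qed
    qed
  qed
qed


end
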